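(* Let $N$ be a finite set and let $f: 2^{N} \to \mathbb{R} \cup \{-\infty\}$ be a function. The following three conditions are equivalent: (M$^{\natural}$-EXC) For any $X, Y \subseteq N$ and $i \in X \setminus Y$, $$f(X) + f(Y) \leq \max\Big[ f(X \setminus \{i\}) + f(Y \cup \{i\}),\ \max_{j \in Y \setminus X} \{ f((X \setminus \{i\}) \cup \{j\}) + f((Y \cup \{i\}) \setminus \{j\}) \} \Big].$$ (M$^{\natural}$-EXC$_{\rm m}$) For any $X, Y \subseteq N$ and $I \subseteq X \setminus Y$, $$f(X) + f(Y) \leq \max_{J \subseteq Y \setminus X} \{ f((X \setminus I) \cup J) + f((Y \setminus J) \cup I) \}.$$ (M$^{\natural}$-EXC$_{\rm ms}$) For any $X, Y \subseteq N$ and $I \subseteq X \setminus Y$, $$f(X) + f(Y) \leq \max_{J \subseteq Y \setminus X,\ |J| \leq |I|} \{ f((X \setminus I) \cup J) + f((Y \setminus J) \cup I) \}.$$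
   Context: Conventions: $(-\infty)+a = a+(-\infty) = (-\infty)+(-\infty) = -\infty$ for $a \in \mathbb{R}$, $-\infty \leq -\infty$, and a maximum taken over an empty set is defined to be $-\infty$. *)

theory Defs
  imports "HOL-Library.Extended_Real"
begin

text \<open>
  The codomain, the reals extended by minus infinity, is rendered by \<^typ>\<open>ereal\<close> with the
  value \<^term>\<open>\<infinity> :: ereal\<close> excluded on the subsets of the ground set. On the remaining values,
  addition on \<^typ>\<open>ereal\<close> satisfies \<open>-\<infinity> + a = a + -\<infinity> = -\<infinity> + -\<infinity> = -\<infinity>\<close>.
\<close>

definition set_function :: "'a set \<Rightarrow> ('a set \<Rightarrow> ereal) \<Rightarrow> bool" where
  "set_function N f \<longleftrightarrow> (\<forall>Z\<subseteq>N. f Z \<noteq> \<infinity>)"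

text \<open>\<^const>\<open>Max\<close> is unspecified on the empty set, where the maximum is to be \<open>-\<infinity>\<close>.\<close>

definition Max_ext :: "ereal set \<Rightarrow> ereal" where
  "Max_ext A = (if A = {} then -\<infinity> else Max A)"

lemma Max_ext_eq_Sup: "finite A \<Longrightarrow> Max_ext A = Sup A"
  by (simp add: Max_ext_def Max_Sup bot_ereal_def)

definition M_nat_EXC :: "'a set \<Rightarrow> ('a set \<Rightarrow> ereal) \<Rightarrow> bool" where
  "M_nat_EXC N f \<longleftrightarrow>
    (\<forall>X Y i. X \<subseteq> N \<longrightarrow> Y \<subseteq> N \<longrightarrow> i \<in> X - Y \<longrightarrow>
      f X + f Y \<le>
        max (f (X - {i}) + f (Y \<union> {i}))
            (Max_ext {f ((X - {i}) \<union> {j}) + f ((Y \<union> {i}) - {j}) | j. j \<in> Y - X}))"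

definition M_nat_EXC_m :: "'a set \<Rightarrow> ('a set \<Rightarrow> ereal) \<Rightarrow> bool" where
  "M_nat_EXC_m N f \<longleftrightarrow>
    (\<forall>X Y I. X \<subseteq> N \<longrightarrow> Y \<subseteq> N \<longrightarrow> I \<subseteq> X - Y \<longrightarrow>
      f X + f Y \<le>
        Max_ext {f ((X - I) \<union> J) + f ((Y - J) \<union> I) | J. J \<subseteq> Y - X})"

definition M_nat_EXC_ms :: "'a set \<Rightarrow> ('a set \<Rightarrow> ereal) \<Rightarrow> bool" where
  "M_nat_EXC_ms N f \<longleftrightarrow>
    (\<forall>X Y I. X \<subseteq> N \<longrightarrow> Y \<subseteq> N \<longrightarrow> I \<subseteq> X - Y \<longrightarrow>
      f X + f Y \<le>
        Max_ext {f ((X - I) \<union> J) + f ((Y - J) \<union> I) | J. J \<subseteq> Y - X \<and> card J \<le> card I})"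

end

theory Submission
  imports Defs
begin

text \<open>
  Write \<open>F\<close> for the family of sets on which \<open>f\<close> is finite and \<open>v\<close> for its real values there. The
  implication from the cardinality-bounded multiple exchange to the plain one is immediate, so two
  implications carry the theorem.

  From single to multiple exchange (\<open>single_imp_multiple_exchange\<close>). Adding dummy elements that
  carry no value makes all sets of \<open>F\<close> equally large, and \<open>f\<close> becomes a valuated matroid: every
  exchange swaps exactly one element against exactly one other
  (\<open>basis_exchange_homogenization\<close>). For this the exchanged elements must be controllable by
  cardinality, which is the content of \<open>size_increasing_exchange\<close> and \<open>balanced_exchange\<close>. In a
  valuated matroid, a partner \<open>J\<close> of \<open>I\<close> has as many elements as \<open>I\<close>; forgetting the dummies in it
  leaves at most \<open>card I\<close> elements, whence the bound on \<open>J\<close>.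

  To find \<open>J\<close>, consider the two functions \<open>J \<mapsto> v ((X - I) \<union> J)\<close> and \<open>J \<mapsto> v ((Y - J) \<union> I)\<close> of
  subsets of \<open>Y - X\<close>. They too are valuated matroids, and their sum has to reach \<open>v X + v Y\<close>. If the
  two arguments may differ, this is possible for every choice of linear prices that charges the
  difference (\<open>relaxed_multiple_exchange\<close>): maximizing over the elements of \<open>Y - X\<close> yields a
  function of the remaining elements that satisfies single exchange again, hence is submodular
  between comparable sets, and submodularity between \<open>X\<close> and \<open>X \<inter> Y\<close> is the claim. A discrete
  Fenchel duality (\<open>intersection_duality\<close>) then makes the two arguments equal: the worst prices
  exist because the maximum of finitely many affine functions attains its infimum if it is bounded
  below (\<open>max_affine_attains_minimum\<close>), at these prices the maximizers of either function are the
  bases of a matroid, and the matroid intersection theorem (\<open>common_independent_set\<close>) gives a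
  common maximizer.

  From multiple to single exchange (\<open>multiple_imp_single_exchange\<close>). The argument passes from
  local to global. Small differences between \<open>X\<close> and \<open>Y\<close> are settled by a few multiple exchanges. In
  a violating pair at minimal distance, prices are chosen such that \<open>X\<close> and \<open>Y\<close> both lose by every
  single exchange on the critical element \<open>i\<close>. Moving \<open>Y\<close> one step towards \<open>X\<close>, in the best way
  possible, yields a pair that is closer and again violates an exchange property at \<open>i\<close>.
\<close>


section \<open>Exchange properties\<close>

text \<open>
  A function with values in \<open>\<real> \<union> {-\<infinity>}\<close> is represented by the family \<open>F\<close> of sets where it is
  finite together with real values \<open>v\<close>, which matter on \<open>F\<close> only. Demanding that both new sets lie in
  \<open>F\<close> accounts for the value \<open>-\<infinity>\<close>.
\<close>
definition exchangeable :: "'a set set \<Rightarrow> ('a set \<Rightarrow> real) \<Rightarrow> 'a set \<Rightarrow> 'a set \<Rightarrow> 'a set \<Rightarrow> 'a set \<Rightarrow> bool" where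
  "exchangeable F v X Y I J \<longleftrightarrow>
     (X - I) \<union> J \<in> F \<and> (Y - J) \<union> I \<in> F \<and> v X + v Y \<le> v ((X - I) \<union> J) + v ((Y - J) \<union> I)"

text \<open>
  The set \<open>J\<close> with at most one element unifies the two alternatives of the exchange axiom: handing
  \<open>i\<close> over without compensation, or against one element \<open>j\<close>.
\<close>
definition single_exchange :: "'a set set \<Rightarrow> ('a set \<Rightarrow> real) \<Rightarrow> bool" where
  "single_exchange F v \<longleftrightarrow>
     (\<forall>X\<in>F. \<forall>Y\<in>F. \<forall>i\<in>X - Y. \<exists>J\<subseteq>Y - X. card J \<le> 1 \<and> exchangeable F v X Y {i} J)"

definition multiple_exchange :: "'a set set \<Rightarrow> ('a set \<Rightarrow> real) \<Rightarrow> bool" where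
  "multiple_exchange F v \<longleftrightarrow>
     (\<forall>X\<in>F. \<forall>Y\<in>F. \<forall>I\<subseteq>X - Y. \<exists>J\<subseteq>Y - X. exchangeable F v X Y I J)"

lemma single_exchangeE:
  assumes "single_exchange F v" "X \<in> F" "Y \<in> F" "i \<in> X" "i \<notin> Y"
  obtains J where "J \<subseteq> Y - X" "card J \<le> 1" "X - {i} \<union> J \<in> F" "insert i (Y - J) \<in> F"
    "v X + v Y \<le> v (X - {i} \<union> J) + v (insert i (Y - J))"
proof -
  obtain J where "J \<subseteq> Y - X" "card J \<le> 1" "exchangeable F v X Y {i} J"
    using assms unfolding single_exchange_def by (meson DiffI)
  then show ?thesis using that unfolding exchangeable_def by simp
qed

lemma multiple_exchangeE:
  assumes "multiple_exchange F v" "X \<in> F" "Y \<in> F" "I \<subseteq> X - Y"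
  obtains J where "J \<subseteq> Y - X" "X - I \<union> J \<in> F" "Y - J \<union> I \<in> F"
    "v X + v Y \<le> v (X - I \<union> J) + v (Y - J \<union> I)"
proof -
  obtain J where "J \<subseteq> Y - X" "exchangeable F v X Y I J"
    using assms unfolding multiple_exchange_def by meson
  then show ?thesis using that unfolding exchangeable_def by simp
qed

lemma sum_exchange:
  fixes p :: "'a \<Rightarrow> real"
  assumes "finite X" "finite Y" "I \<subseteq> X - Y" "J \<subseteq> Y - X"
  shows "sum p ((X - I) \<union> J) + sum p ((Y - J) \<union> I) = sum p X + sum p Y"
proof -
  have fin: "finite I" "finite J" using assms finite_subset by blast+
  have sub: "I \<subseteq> X" "J \<subseteq> Y" using assms by blast+
  have "sum p ((X - I) \<union> J) = sum p X - sum p I + sum p J"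
    using assms fin sum_diff[OF assms(1) sub(1), of p] by (subst sum.union_disjoint) auto
  moreover have "sum p ((Y - J) \<union> I) = sum p Y - sum p J + sum p I"
    using assms fin sum_diff[OF assms(2) sub(2), of p] by (subst sum.union_disjoint) auto
  ultimately show ?thesis by simp
qed

text \<open>
  Exchanges redistribute elements between the two sets, so linear prices \<open>p\<close> cancel in the
  inequality. All exchange properties may therefore be studied after a convenient choice of prices.
\<close>
lemma exchangeable_add_sum:
  assumes "finite X" "finite Y" "I \<subseteq> X - Y" "J \<subseteq> Y - X"
  shows "exchangeable F (\<lambda>Z. v Z + sum p Z) X Y I J \<longleftrightarrow> exchangeable F v X Y I J"
  using sum_exchange[OF assms, of p] unfolding exchangeable_def by auto

lemma single_exchange_add_sum:
  assumes "single_exchange F v" "\<And>X. X \<in> F \<Longrightarrow> finite X"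
  shows "single_exchange F (\<lambda>Z. v Z + sum p Z)"
  unfolding single_exchange_def
proof (intro ballI)
  fix X Y i assume *: "X \<in> F" "Y \<in> F" "i \<in> X - Y"
  then obtain J where "J \<subseteq> Y - X" "card J \<le> 1" "exchangeable F v X Y {i} J"
    using assms(1) unfolding single_exchange_def by meson
  then show "\<exists>J\<subseteq>Y - X. card J \<le> 1 \<and> exchangeable F (\<lambda>Z. v Z + sum p Z) X Y {i} J"
    using exchangeable_add_sum[of X Y "{i}" J F v p] assms(2) * by auto
qed

text \<open>
  Used to choose prices: a price is subject to a lower and an upper bound, each of which is present
  only if a certain set lies in \<open>F\<close>.
\<close>
lemma real_between:
  fixes a b :: real
  assumes "P \<Longrightarrow> Q \<Longrightarrow> a < b"
  obtains q where "P \<Longrightarrow> a < q" "Q \<Longrightarrow> q < b"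
  using assms by (metis dense gt_ex lt_ex)

lemma finite_maximizer:
  fixes g :: "'b \<Rightarrow> real"
  assumes "finite S" "S \<noteq> {}"
  obtains z where "z \<in> S" "\<And>y. y \<in> S \<Longrightarrow> g y \<le> g z"
proof -
  have "Max (g ` S) \<in> g ` S" using assms by (intro Max_in) auto
  then obtain z where "z \<in> S" "g z = Max (g ` S)" by auto
  then show ?thesis using that assms by auto
qed

section \<open>Exchanges controlled by cardinality\<close>

lemma card_exchange_ge:
  assumes "finite Z" "J \<subseteq> Z" "card J \<le> 1" "a \<notin> Z"
  shows "card Z \<le> card (insert a (Z - J))"
proof -
  have "card (Z - J) = card Z - card J"
    using assms by (meson card_Diff_subset finite_subset)
  then show ?thesis using assms by auto
qed

text \<open>
  If the larger set \<open>Y\<close> could not give any element to \<open>X'\<close>, prices on \<open>B = Y - X\<close> would exist at which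
  adding an element of \<open>B\<close> to \<open>X'\<close> and removing one from \<open>Y\<close> both lose strictly. At such prices \<open>Y\<close>
  is best among the sets \<open>Z\<close> with \<open>Z - B = X \<inter> Y\<close>. Enforcing the elements of \<open>X - Y\<close> one after the
  other, each time with the best choice of elements of \<open>B\<close>, drives out at most one element of \<open>B\<close> at a time
  and so never decreases the size (in economics: the law of aggregate demand). The result is a best set
  \<open>Z\<close> with \<open>Z - B = X\<close> that is at least as large as \<open>Y\<close>, hence contains an element of \<open>B\<close>. But \<open>X'\<close>
  loses by receiving this element, so \<open>Z\<close> would gain by giving it away.
\<close>
lemma size_increasing_exchange:
  assumes E: "finite E" "F \<subseteq> Pow E" and ex: "single_exchange F v"
    and F: "X \<in> F" "X' \<in> F" "Y \<in> F" and sub: "X' \<subseteq> X" and card: "card X < card Y"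
  shows "\<exists>j\<in>Y - X. insert j X' \<in> F \<and> Y - {j} \<in> F \<and> v X' + v Y \<le> v (insert j X') + v (Y - {j})"
proof (rule ccontr)
  assume neg: "\<not> ?thesis"
  have finF: "finite Z" if "Z \<in> F" for Z using that E finite_subset by blast
  have "\<exists>q. (Y - {j} \<in> F \<longrightarrow> v (Y - {j}) - v Y < q) \<and> (insert j X' \<in> F \<longrightarrow> q < v X' - v (insert j X'))"
    if "j \<in> Y - X" for j
    using neg that real_between[of "Y - {j} \<in> F" "insert j X' \<in> F" "v (Y - {j}) - v Y" "v X' - v (insert j X')"]
    by (smt (verit, best))
  then obtain p where p: "\<And>j. j \<in> Y - X \<Longrightarrow> Y - {j} \<in> F \<Longrightarrow> v (Y - {j}) - v Y < p j"
      "\<And>j. j \<in> Y - X \<Longrightarrow> insert j X' \<in> F \<Longrightarrow> p j < v X' - v (insert j X')"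
    by metis
  define g where "g Z = v Z + sum p Z" for Z
  have exg: "single_exchange F g"
    using single_exchange_add_sum[OF ex finF, of p] unfolding g_def by simp
  have gX': "g (insert j X') < g X'" if "j \<in> Y - X" "insert j X' \<in> F" for j
  proof -
    have "sum p (insert j X') = p j + sum p X'" using that sub finF[OF F(2)] by (subst sum.insert) auto
    then show ?thesis using p(2)[OF that] by (simp add: g_def)
  qed
  have gY: "g (Y - {j}) < g Y" if "j \<in> Y - X" "Y - {j} \<in> F" for j
    using p(1)[OF that] that finF[OF F(3)] by (auto simp: g_def sum_diff1)
  have Ymax: "g (Y - V) \<le> g Y" if "V \<subseteq> Y - X" "Y - V \<in> F" for V
  proof -
    have "finite V" using that finF[OF F(3)] finite_subset by blast
    then show ?thesis using that
    proof (induction V rule: finite_induct)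
      case (insert j V)
      have j: "j \<in> Y - X" "j \<in> Y" "j \<notin> Y - insert j V" and V: "V \<subseteq> Y - X"
        using insert.prems by auto
      obtain J where J: "J \<subseteq> (Y - insert j V) - Y" "card J \<le> 1" "Y - {j} \<union> J \<in> F"
        "insert j (Y - insert j V - J) \<in> F"
        "g Y + g (Y - insert j V) \<le> g (Y - {j} \<union> J) + g (insert j (Y - insert j V - J))"
        by (rule single_exchangeE[OF exg F(3) insert.prems(2) j(2,3)])
      have "J = {}" using J(1) by auto
      moreover have "insert j (Y - insert j V) = Y - V" using insert.hyps j(2) by auto
      ultimately have "Y - {j} \<in> F" "Y - V \<in> F" "g Y + g (Y - insert j V) \<le> g (Y - {j}) + g (Y - V)"
        using J by auto
      then show ?case using insert.IH[OF V] gY[OF j(1)] by linarith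
    qed simp
  qed
  define B where "B = Y - X"
  \<comment> \<open>The maximizers at level L are the best sets Z whose part outside B is the union of X \<inter> Y and L.\<close>
  have step: "\<exists>Z\<in>F. Z - B = (X \<inter> Y) \<union> L \<and> card Y \<le> card Z \<and>
      (\<forall>Z'\<in>F. Z' - B = (X \<inter> Y) \<union> L \<longrightarrow> g Z' \<le> g Z)" if "L \<subseteq> X - Y" for L
  proof -
    have "finite L" using that finF[OF F(1)] finite_subset by blast
    then show ?thesis using that
    proof (induction L rule: finite_induct)
      case empty
      have "g Z' \<le> g Y" if "Z' \<in> F" "Z' - B = X \<inter> Y" for Z'
      proof -
        have "Z' = Y - (B - Z')" using that unfolding B_def by blast
        then show ?thesis using Ymax[of "B - Z'"] that unfolding B_def by auto
      qed
      moreover have "Y - B = X \<inter> Y" unfolding B_def by auto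
      ultimately show ?case using F by auto
    next
      case (insert a L)
      then obtain Z where Z: "Z \<in> F" "Z - B = (X \<inter> Y) \<union> L" "card Y \<le> card Z"
        "\<And>Z'. Z' \<in> F \<Longrightarrow> Z' - B = (X \<inter> Y) \<union> L \<Longrightarrow> g Z' \<le> g Z" by auto
      have a: "a \<in> X" "a \<notin> Y" "a \<notin> Z" "a \<notin> B" using insert Z(2) unfolding B_def by auto
      define S where "S = {Z'\<in>F. Z' - B = (X \<inter> Y) \<union> insert a L}"
      \<comment> \<open>Exchanging with X shows that the next level is not empty; its maximizer Z' is then compared with Z.\<close>
      obtain J where J: "J \<subseteq> Z - X" "insert a (Z - J) \<in> F"
        by (rule single_exchangeE[OF exg F(1) Z(1) a(1,3)])
      have JB: "J \<subseteq> B" using J(1) Z(2) insert.prems unfolding B_def by blast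
      have "insert a (Z - J) \<in> S" unfolding S_def using J JB Z(2) a by blast
      moreover have "finite S" unfolding S_def using E finite_subset by fastforce
      ultimately obtain Z' where Z': "Z' \<in> S" "\<And>Y. Y \<in> S \<Longrightarrow> g Y \<le> g Z'"
        using finite_maximizer[of S g] by blast
      have Z'F: "Z' \<in> F" "Z' - B = (X \<inter> Y) \<union> insert a L" using Z'(1) unfolding S_def by auto
      have aZ': "a \<in> Z'" using Z'F(2) by auto
      obtain K where K: "K \<subseteq> Z - Z'" "card K \<le> 1" "Z' - {a} \<union> K \<in> F" "insert a (Z - K) \<in> F"
        "g Z' + g Z \<le> g (Z' - {a} \<union> K) + g (insert a (Z - K))"
        by (rule single_exchangeE[OF exg Z'F(1) Z(1) aZ' a(3)])
      have KB: "K \<subseteq> B" using K(1) Z(2) Z'F(2) by blast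
      have "Z' - {a} \<union> K - B = (X \<inter> Y) \<union> L" using KB Z'F(2) a insert.hyps by blast
      then have "g Z' \<le> g (insert a (Z - K))" using Z(4)[OF K(3)] K(5) by linarith
      moreover have "insert a (Z - K) - B = (X \<inter> Y) \<union> insert a L" using KB Z(2) a by blast
      moreover have "card Z \<le> card (insert a (Z - K))"
        using card_exchange_ge[OF finF[OF Z(1)] _ K(2) a(3)] K(1) by blast
      ultimately show ?case using K(4) Z(3) Z'(2) unfolding S_def
        by (intro bexI[of _ "insert a (Z - K)"]) (auto intro: order_trans)
    qed
  qed
  obtain Z where Z: "Z \<in> F" "Z - B = X" "card Y \<le> card Z" "\<And>Z'. Z' \<in> F \<Longrightarrow> Z' - B = X \<Longrightarrow> g Z' \<le> g Z"
    using step[of "X - Y"] by (auto simp: Int_Diff Un_Diff_Int Int_commute)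
  have "Z \<noteq> X" using Z(3) card by auto
  then obtain j where j: "j \<in> Z" "j \<in> B" using Z(2) by blast
  have jX: "j \<notin> X'" "j \<in> Y - X" using j sub unfolding B_def by auto
  obtain J where J: "J \<subseteq> X' - Z" "card J \<le> 1" "Z - {j} \<union> J \<in> F" "insert j (X' - J) \<in> F"
    "g Z + g X' \<le> g (Z - {j} \<union> J) + g (insert j (X' - J))"
    by (rule single_exchangeE[OF exg Z(1) F(2) j(1) jX(1)])
  have "J = {}" using J(1) Z(2) sub by blast
  then have "g Z < g (Z - {j})" "Z - {j} \<in> F" using J gX'[OF jX(2)] by auto
  moreover have "Z - {j} - B = X" using Z(2) j by blast
  ultimately show False using Z(4) by fastforce
qed

text \<open>
  A single exchange without compensation leads to \<open>X - {i}\<close> and \<open>Y \<union> {i}\<close>, whose sizes differ by at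
  least two; the previous lemma then moves an element of \<open>Y\<close> back. It is applied with the pair
  \<open>X - {i} \<subseteq> X\<close>, which excludes \<open>i\<close> itself as the element to be moved.
\<close>
lemma balanced_exchange:
  assumes E: "finite E" "F \<subseteq> Pow E" and ex: "single_exchange F v"
    and F: "X \<in> F" "Y \<in> F" and card: "card X \<le> card Y" and i: "i \<in> X" "i \<notin> Y"
  shows "\<exists>j\<in>Y - X. exchangeable F v X Y {i} {j}"
proof -
  have fin: "finite X" "finite Y" using E F finite_subset by blast+
  obtain J where J: "J \<subseteq> Y - X" "card J \<le> 1" "X - {i} \<union> J \<in> F" "insert i (Y - J) \<in> F"
    "v X + v Y \<le> v (X - {i} \<union> J) + v (insert i (Y - J))"
    by (rule single_exchangeE[OF ex F i])
  show ?thesis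
  proof (cases "J = {}")
    case True
    then have J': "X - {i} \<in> F" "insert i Y \<in> F" "v X + v Y \<le> v (X - {i}) + v (insert i Y)"
      using J by auto
    have "card X < card (insert i Y)" using card i fin by auto
    then obtain j where j: "j \<in> insert i Y - X" "insert j (X - {i}) \<in> F" "insert i Y - {j} \<in> F"
      "v (X - {i}) + v (insert i Y) \<le> v (insert j (X - {i})) + v (insert i Y - {j})"
      using size_increasing_exchange[OF E ex F(1) J'(1,2)] by blast
    have "insert i Y - {j} = Y - {j} \<union> {i}" "insert j (X - {i}) = X - {i} \<union> {j}" using i j by auto
    then show ?thesis using i j J'(3) unfolding exchangeable_def by force
  next
    case False
    have "finite J" using J(1) fin finite_subset by blast
    then have "card J = 1" using J(2) False by (simp add: Suc_leI card_gt_0_iff le_antisym)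
    then obtain j where "J = {j}" by (auto simp: card_1_singleton_iff)
    then show ?thesis using J unfolding exchangeable_def by auto
  qed
qed

section \<open>From multiple to single exchange\<close>

lemma card_le_1_cases:
  assumes "finite J" "card J \<le> 1"
  obtains "J = {}" | j where "J = {j}"
  using assms by (metis One_nat_def card_0_eq card_1_singletonE le_Suc_eq le_zero_eq)

definition distance :: "'a set \<Rightarrow> 'a set \<Rightarrow> nat" where
  "distance X Y = card ((X - Y) \<union> (Y - X))"

text \<open>
  The proof of balanced exchange only involves sets between \<open>X \<inter> Y\<close> and \<open>X \<union> Y\<close>. In an induction on
  the distance it is thus available as soon as single exchange is known up to the distance of \<open>X\<close>
  and \<open>Y\<close>.
\<close>
lemma balanced_exchange_interval:
  assumes E: "finite E" "F \<subseteq> Pow E" and F: "X \<in> F" "Y \<in> F"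
    and ex: "\<And>P Q k. P \<in> F \<Longrightarrow> Q \<in> F \<Longrightarrow> distance P Q \<le> distance X Y \<Longrightarrow> k \<in> P - Q
      \<Longrightarrow> \<exists>J\<subseteq>Q - P. card J \<le> 1 \<and> exchangeable F v P Q {k} J"
    and card: "card X \<le> card Y" and i: "i \<in> X" "i \<notin> Y"
  shows "\<exists>j\<in>Y - X. exchangeable F v X Y {i} {j}"
proof -
  define F' where "F' = {Z \<in> F. X \<inter> Y \<subseteq> Z \<and> Z \<subseteq> X \<union> Y}"
  have fin: "finite X" "finite Y" using E F finite_subset by blast+
  have "single_exchange F' v"
    unfolding single_exchange_def
  proof (intro ballI)
    fix P Q k assume PQ: "P \<in> F'" "Q \<in> F'" "k \<in> P - Q"
    have "distance P Q \<le> distance X Y"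
      unfolding distance_def using PQ fin by (intro card_mono) (auto simp: F'_def)
    then obtain J where J: "J \<subseteq> Q - P" "card J \<le> 1" "exchangeable F v P Q {k} J"
      using ex[of P Q k] PQ unfolding F'_def by blast
    moreover have "exchangeable F' v P Q {k} J"
      using J PQ unfolding exchangeable_def F'_def by auto
    ultimately show "\<exists>J\<subseteq>Q - P. card J \<le> 1 \<and> exchangeable F' v P Q {k} J" by blast
  qed
  moreover have "F' \<subseteq> Pow E" "X \<in> F'" "Y \<in> F'" using E F unfolding F'_def by auto
  ultimately obtain j where j: "j \<in> Y - X" "exchangeable F' v X Y {i} {j}"
    using balanced_exchange[of E F' v X Y i] E(1) card i by blast
  then have "exchangeable F v X Y {i} {j}" unfolding exchangeable_def F'_def by simp
  then show ?thesis using j(1) by blast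
qed

text \<open>
  The next two lemmas provide steps from \<open>Y\<close> towards \<open>X\<close> that stay inside \<open>F\<close>. Here, take a minimal
  \<open>V\<close> such that \<open>Y - V \<union> {u}\<close> lies in \<open>F\<close>; if it had two elements, exchanging one of them between
  this set and \<open>Y\<close> would produce a smaller \<open>V\<close>.
\<close>
lemma multiple_exchange_add_element:
  assumes mult: "multiple_exchange F v" and F: "X \<in> F" "Y \<in> F" "finite Y" and u: "u \<in> X - Y"
  shows "\<exists>V\<subseteq>Y - X. card V \<le> 1 \<and> Y - V \<union> {u} \<in> F"
proof -
  define P where "P V \<longleftrightarrow> V \<subseteq> Y - X \<and> Y - V \<union> {u} \<in> F" for V
  have "{u} \<subseteq> X - Y" using u by blast
  then obtain J where "J \<subseteq> Y - X" "X - {u} \<union> J \<in> F" "Y - J \<union> {u} \<in> F"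
    "v X + v Y \<le> v (X - {u} \<union> J) + v (Y - J \<union> {u})"
    by (rule multiple_exchangeE[OF mult F(1,2)])
  then have "P J" unfolding P_def by blast
  then obtain V where V: "P V" "\<And>V'. P V' \<Longrightarrow> card V \<le> card V'"
    using ex_has_least_nat[of P J card] by blast
  have finV: "finite V" using V(1) F(3) finite_subset unfolding P_def by blast
  have "card V \<le> 1"
  proof (rule ccontr)
    assume "\<not> card V \<le> 1"
    then have c: "card V \<ge> 2" by simp
    then obtain w where w: "w \<in> V" by fastforce
    define Z where "Z = Y - V \<union> {u}"
    have Z: "Z \<in> F" using V(1) unfolding P_def Z_def by blast
    have "{w} \<subseteq> Y - Z" using w V(1) u unfolding P_def Z_def by blast
    then obtain K where K: "K \<subseteq> Z - Y" "Y - {w} \<union> K \<in> F" "Z - K \<union> {w} \<in> F"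
      "v Y + v Z \<le> v (Y - {w} \<union> K) + v (Z - K \<union> {w})"
      by (rule multiple_exchangeE[OF mult F(2) Z])
    show False
    proof (cases "K = {}")
      case True
      have "Z - K \<union> {w} = Y - (V - {w}) \<union> {u}" using True w V(1) unfolding Z_def P_def by blast
      then have "P (V - {w})" using K(3) V(1) unfolding P_def by auto
      then show False using V(2)[of "V - {w}"] w finV card_Diff1_less[of V w] by simp
    next
      case False
      then have "K = {u}" using K(1) unfolding Z_def by blast
      then have "P {w}" using K(2) w V(1) unfolding P_def by auto
      then show False using V(2)[of "{w}"] c by simp
    qed
  qed
  then show ?thesis using V(1) unfolding P_def by blast
qed

text \<open>
  Exchange two elements \<open>a\<close>, \<open>b\<close> of \<open>Y - X\<close> at once; the resulting set still differs from \<open>Y\<close> so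
  little that exchanging \<open>a\<close> between the two leaves \<open>Y - {a}\<close> or \<open>Y - {b}\<close>.
\<close>
lemma multiple_exchange_remove_element:
  assumes mult: "multiple_exchange F v" and F: "X \<in> F" "Y \<in> F"
    and A: "X - Y = {i}" and B: "finite (Y - X)" "card (Y - X) \<ge> 2"
  shows "\<exists>w\<in>Y - X. Y - {w} \<in> F"
proof -
  obtain a b where a: "a \<in> Y - X" and b: "b \<in> Y - X - {a}"
    using obtain_subset_with_card_n[OF B(2)] unfolding card_2_iff
    by (metis DiffI insertI1 insertI2 singletonD subsetD)
  have "{a, b} \<subseteq> Y - X" using a b by blast
  then obtain J where J: "J \<subseteq> X - Y" "Y - {a, b} \<union> J \<in> F" "X - J \<union> {a, b} \<in> F"
      "v Y + v X \<le> v (Y - {a, b} \<union> J) + v (X - J \<union> {a, b})"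
    by (rule multiple_exchangeE[OF mult F(2,1)])
  define Z where "Z = Y - {a, b} \<union> J"
  have "{a} \<subseteq> Y - Z" using a A J(1) unfolding Z_def by blast
  then obtain K where K: "K \<subseteq> Z - Y" "Y - {a} \<union> K \<in> F" "Z - K \<union> {a} \<in> F"
      "v Y + v Z \<le> v (Y - {a} \<union> K) + v (Z - K \<union> {a})"
    by (rule multiple_exchangeE[OF mult F(2) J(2)[folded Z_def]])
  show ?thesis
  proof (cases "K = {}")
    case True
    then show ?thesis using K(2) a by auto
  next
    case False
    have "K \<subseteq> J" "J \<subseteq> {i}" using K(1) J(1) A unfolding Z_def by auto
    then have "K = {i}" "J = {i}" using False by auto
    then have "Z - K \<union> {a} = Y - {b}" using a b A unfolding Z_def by blast
    then show ?thesis using K(3) b by auto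
  qed
qed

text \<open>
  Multiple exchange with \<open>I = {i}\<close> is vacuous for \<open>X - Y = {i}\<close>, since \<open>J = Y - X\<close> interchanges \<open>X\<close> and
  \<open>Y\<close>. The exchange is started from the element \<open>k\<close> of \<open>Y\<close> instead: after interchanging the two
  resulting sets, it is an exchange of \<open>i\<close> against \<open>l\<close> or against \<open>k\<close>.
\<close>
lemma single_exchange_1_2:
  assumes mult: "multiple_exchange F v" and F: "X \<in> F" "Y \<in> F"
    and A: "X - Y = {i}" and B: "Y - X = {k, l}" "k \<noteq> l"
  shows "\<exists>J\<subseteq>Y - X. card J \<le> 1 \<and> exchangeable F v X Y {i} J"
proof -
  have "{k} \<subseteq> Y - X" using B by blast
  then obtain J where J: "J \<subseteq> X - Y" "Y - {k} \<union> J \<in> F" "X - J \<union> {k} \<in> F"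
      "v Y + v X \<le> v (Y - {k} \<union> J) + v (X - J \<union> {k})"
    by (rule multiple_exchangeE[OF mult F(2,1)])
  consider "J = {}" | "J = {i}" using J(1) unfolding A subset_singleton_iff by blast
  then show ?thesis
  proof cases
    case 1
    then have "Y - {k} \<union> J = X - {i} \<union> {l}" "X - J \<union> {k} = Y - {l} \<union> {i}" using A B by blast+
    then have "exchangeable F v X Y {i} {l}" using J unfolding exchangeable_def by simp
    then show ?thesis using B by (intro exI[of _ "{l}"]) auto
  next
    case 2
    then have "exchangeable F v X Y {i} {k}" using J unfolding exchangeable_def by simp
    then show ?thesis using B by (intro exI[of _ "{k}"]) auto
  qed
qed

text \<open>
  The only undesired outcome of removing \<open>i\<close> is \<open>J = {k, l}\<close>. Then two further exchanges are made, on
  \<open>k\<close> and on \<open>j\<close>, between the sets obtained so far. Writing a pair of sets by the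
  elements outside \<open>X \<inter> Y\<close>, the chain is \<open>ij | kl\<close>, \<open>jkl | i\<close>, \<open>ijl | k\<close>, and each way of leaving
  it is an exchange of the required form.
\<close>
lemma single_exchange_2_2:
  assumes mult: "multiple_exchange F v" and F: "X \<in> F" "Y \<in> F"
    and A: "X - Y = {i, j}" "i \<noteq> j" and B: "Y - X = {k, l}" "k \<noteq> l"
  shows "\<exists>J\<subseteq>Y - X. card J \<le> 1 \<and> exchangeable F v X Y {i} J"
proof -
  have exI1: ?thesis if "exchangeable F v X Y {i} J" "J = {} \<or> J = {k} \<or> J = {l}" for J
    using that B by (intro exI[of _ J]) auto
  have "{i} \<subseteq> X - Y" using A by blast
  then obtain J where J: "J \<subseteq> Y - X" "X - {i} \<union> J \<in> F" "Y - J \<union> {i} \<in> F"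
      "v X + v Y \<le> v (X - {i} \<union> J) + v (Y - J \<union> {i})"
    by (rule multiple_exchangeE[OF mult F])
  have exJ: "exchangeable F v X Y {i} J" using J unfolding exchangeable_def by simp
  show ?thesis
  proof (cases "J = {k, l}")
    case False
    then have "J = {} \<or> J = {k} \<or> J = {l}" using J(1) unfolding B(1) by blast
    then show ?thesis using exI1[OF exJ] by blast
  next
    case Jkl: True
    define P where "P = X - {i} \<union> {k, l}"
    define Q where "Q = Y - {k, l} \<union> {i}"
    have PQ: "P \<in> F" "Q \<in> F" "v X + v Y \<le> v P + v Q" using J Jkl unfolding P_def Q_def by auto
    have "{k} \<subseteq> P - Q" using A B unfolding P_def Q_def by blast
    then obtain K where K: "K \<subseteq> Q - P" "P - {k} \<union> K \<in> F" "Q - K \<union> {k} \<in> F"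
      "v P + v Q \<le> v (P - {k} \<union> K) + v (Q - K \<union> {k})"
      by (rule multiple_exchangeE[OF mult PQ(1,2)])
    have "Q - P = {i}" using A B unfolding P_def Q_def by blast
    then consider "K = {}" | "K = {i}" using K(1) subset_singleton_iff by metis
    then show ?thesis
    proof cases
      case 1
      then have "P - {k} \<union> K = X - {i} \<union> {l}" "Q - K \<union> {k} = Y - {l} \<union> {i}"
        using A B unfolding P_def Q_def by blast+
      then have "exchangeable F v X Y {i} {l}" using K PQ(3) unfolding exchangeable_def by simp
      then show ?thesis using exI1 by blast
    next
      case 2
      define R where "R = P - {k} \<union> {i}"
      define S where "S = Q - {i} \<union> {k}"
      have RS: "R \<in> F" "S \<in> F" "v X + v Y \<le> v R + v S"
        using K PQ 2 unfolding R_def S_def by auto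
      have "{j} \<subseteq> R - S" using A B unfolding R_def S_def P_def Q_def by blast
      then obtain L where L: "L \<subseteq> S - R" "R - {j} \<union> L \<in> F" "S - L \<union> {j} \<in> F"
        "v R + v S \<le> v (R - {j} \<union> L) + v (S - L \<union> {j})"
        by (rule multiple_exchangeE[OF mult RS(1,2)])
      have "S - R = {k}" using A B unfolding R_def S_def P_def Q_def by blast
      then consider "L = {}" | "L = {k}" using L(1) subset_singleton_iff by metis
      then show ?thesis
      proof cases
        case 1
        then have "R - {j} \<union> L = Y - {k} \<union> {i}" "S - L \<union> {j} = X - {i} \<union> {k}"
          using A B unfolding R_def S_def P_def Q_def by blast+
        then have "exchangeable F v X Y {i} {k}" using L RS(3) unfolding exchangeable_def by simp
        then show ?thesis using exI1 by blast
      next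
        case 2
        then have "R - {j} \<union> L = Y - {} \<union> {i}" "S - L \<union> {j} = X - {i} \<union> {}"
          using A B unfolding R_def S_def P_def Q_def by blast+
        then have "exchangeable F v X Y {i} {}" using L RS(3) unfolding exchangeable_def by simp
        then show ?thesis using exI1 by blast
      qed
    qed
  qed
qed

text \<open>
  Every potential exchange \<open>J\<close> constrains only the number \<open>q J\<close> by which it changes the price of \<open>X\<close>,
  and these numbers can be prescribed independently for the empty set and for all singletons.
\<close>
lemma separating_prices:
  assumes fin: "finite X" "finite Y" and i: "i \<in> X - Y"
    and neg: "\<And>J. J \<subseteq> Y - X \<Longrightarrow> card J \<le> 1 \<Longrightarrow> \<not> exchangeable F v X Y {i} J"
  obtains p where
    "\<And>J. J \<subseteq> Y - X \<Longrightarrow> card J \<le> 1 \<Longrightarrow> X - {i} \<union> J \<in> F \<Longrightarrow>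
      v (X - {i} \<union> J) + sum p (X - {i} \<union> J) < v X + sum p X"
    "\<And>J. J \<subseteq> Y - X \<Longrightarrow> card J \<le> 1 \<Longrightarrow> Y - J \<union> {i} \<in> F \<Longrightarrow>
      v (Y - J \<union> {i}) + sum p (Y - J \<union> {i}) < v Y + sum p Y"
proof -
  have "\<exists>q. (Y - J \<union> {i} \<in> F \<longrightarrow> v (Y - J \<union> {i}) - v Y < q) \<and>
      (X - {i} \<union> J \<in> F \<longrightarrow> q < v X - v (X - {i} \<union> J))" if "J \<subseteq> Y - X" "card J \<le> 1" for J
    using neg[OF that] unfolding exchangeable_def
    using real_between[of "Y - J \<union> {i} \<in> F" "X - {i} \<union> J \<in> F" "v (Y - J \<union> {i}) - v Y" "v X - v (X - {i} \<union> J)"]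
    by (smt (verit, best))
  then obtain q where q:
    "\<And>J. J \<subseteq> Y - X \<Longrightarrow> card J \<le> 1 \<Longrightarrow> Y - J \<union> {i} \<in> F \<Longrightarrow> v (Y - J \<union> {i}) - v Y < q J"
    "\<And>J. J \<subseteq> Y - X \<Longrightarrow> card J \<le> 1 \<Longrightarrow> X - {i} \<union> J \<in> F \<Longrightarrow> q J < v X - v (X - {i} \<union> J)"
    by metis
  \<comment> \<open>Removing i from X changes its price by q {}, and replacing i by z changes it by q {z}.\<close>
  define p where "p z = (if z = i then - q {} else q {z} - q {})" for z
  have pX: "sum p (X - {i} \<union> J) = sum p X + q J" if J: "J \<subseteq> Y - X" "card J \<le> 1" for J
  proof -
    have finJ: "finite J" using J(1) fin finite_subset by blast
    have "p i = - q {}" by (simp add: p_def)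
    then have rem: "sum p (X - {i}) = sum p X + q {}" using fin i by (simp add: sum_diff1)
    from finJ J(2) show ?thesis
    proof (rule card_le_1_cases)
      fix j assume j: "J = {j}"
      have "j \<noteq> i" "j \<notin> X - {i}" using j J(1) i by auto
      then have "sum p (insert j (X - {i})) = sum p X + q {j}"
        using fin rem p_def[of j] by simp
      then show ?thesis using j by simp
    qed (use rem in simp)
  qed
  have pY: "sum p (Y - J \<union> {i}) = sum p Y - q J" if J: "J \<subseteq> Y - X" "card J \<le> 1" for J
    using sum_exchange[OF fin _ J(1), of "{i}" p] pX[OF J] i by simp
  show ?thesis
    by (rule that[of p]) (use pX pY q in \<open>smt (verit, best)\<close>)+
qed

lemma distance_le:
  assumes "X - Y \<union> (Y - X) \<subseteq> D" "finite D"
  shows "distance X Y \<le> card D"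
  unfolding distance_def using assms by (rule card_mono[rotated])

text \<open>
  Induction on the distance of \<open>X\<close> and \<open>Y\<close>. Assume that no single exchange on \<open>i\<close> exists, and choose
  separating prices. If \<open>i\<close> is not the only element of \<open>X - Y\<close>, pick another one, \<open>u\<close>, and let \<open>Q\<close> be the
  best set that arises from \<open>Y\<close> by inserting \<open>u\<close> and removing at most one element of \<open>Y - X\<close>. By
  induction some single exchange on \<open>i\<close> between \<open>X\<close> and \<open>Q\<close> exists. As \<open>X\<close> loses, \<open>Q\<close> gains and
  becomes a set \<open>R\<close>, and a local exchange between \<open>R\<close> and \<open>Y\<close>, which are at distance at most four, contradicts
  that \<open>Y\<close> loses or that \<open>Q\<close> is best. If \<open>X - Y = {i}\<close>, the same is done with the best set
  \<open>Y - {w}\<close>; there an uncompensated exchange between \<open>X\<close> and \<open>Y - {w}\<close> would be of no use, and it is avoided by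
  means of balanced exchange.
\<close>
theorem multiple_imp_single_exchange:
  assumes E: "finite E" "F \<subseteq> Pow E" and mult: "multiple_exchange F v"
  shows "single_exchange F v"
proof -
  have finF: "finite Z" if "Z \<in> F" for Z using that E finite_subset by blast
  have "\<exists>J\<subseteq>Y - X. card J \<le> 1 \<and> exchangeable F v X Y {i} J"
    if "X \<in> F" "Y \<in> F" "i \<in> X - Y" for X Y i
    using that
  proof (induction "distance X Y" arbitrary: X Y i rule: less_induct)
    case less
    note F = less.prems(1,2) and i = less.prems(3)
    define A where "A = X - Y"
    define B where "B = Y - X"
    have fin: "finite X" "finite Y" "finite A" "finite B" using finF F unfolding A_def B_def by auto
    have AB: "i \<in> A" "A \<inter> Y = {}" "B \<subseteq> Y" "B \<inter> X = {}" "A \<subseteq> X" using i unfolding A_def B_def by auto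
    have dist: "distance X Y = card A + card B"
      unfolding distance_def using fin by (subst card_Un_disjoint) (auto simp: A_def B_def)
    show ?case
    proof (rule ccontr)
      assume neg: "\<not> ?case"
      have B2: "card B \<ge> 2"
      proof (rule ccontr)
        assume "\<not> card B \<ge> 2"
        then have B1: "card B \<le> 1" by simp
        have "{i} \<subseteq> X - Y" using i by blast
        then obtain J where J: "J \<subseteq> Y - X" "exchangeable F v X Y {i} J"
          using mult F unfolding multiple_exchange_def by meson
        have "card J \<le> 1" using card_mono[OF fin(4), of J] J(1) B1 unfolding B_def by linarith
        then show False using neg J by blast
      qed
      obtain p where p:
        "\<And>J. J \<subseteq> Y - X \<Longrightarrow> card J \<le> 1 \<Longrightarrow> X - {i} \<union> J \<in> F \<Longrightarrow>
          v (X - {i} \<union> J) + sum p (X - {i} \<union> J) < v X + sum p X"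
        "\<And>J. J \<subseteq> Y - X \<Longrightarrow> card J \<le> 1 \<Longrightarrow> Y - J \<union> {i} \<in> F \<Longrightarrow>
          v (Y - J \<union> {i}) + sum p (Y - J \<union> {i}) < v Y + sum p Y"
        using separating_prices[OF fin(1,2) i, of F v] neg by blast
      define g where "g Z = v Z + sum p Z" for Z
      have gX: "g (X - {i} \<union> J) < g X" if "J \<subseteq> B" "card J \<le> 1" "X - {i} \<union> J \<in> F" for J
        using p(1)[of J] that unfolding g_def B_def by blast
      have gY: "g (Y - J \<union> {i}) < g Y" if "J \<subseteq> B" "card J \<le> 1" "Y - J \<union> {i} \<in> F" for J
        using p(2)[of J] that unfolding g_def B_def by blast
      have IH: "\<exists>J\<subseteq>Q - P. card J \<le> 1 \<and> exchangeable F g P Q {k} J"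
        if PQ: "distance P Q < distance X Y" "P \<in> F" "Q \<in> F" "k \<in> P - Q" for P Q k
      proof -
        obtain J where J: "J \<subseteq> Q - P" "card J \<le> 1" "exchangeable F v P Q {k} J"
          using less.hyps[OF PQ] by blast
        have "{k} \<subseteq> P - Q" using PQ by blast
        then have "exchangeable F g P Q {k} J"
          using J exchangeable_add_sum[OF finF[OF PQ(2)] finF[OF PQ(3)] _ J(1), of "{k}" F v p]
          unfolding g_def by blast
        then show ?thesis using J by blast
      qed
      have IHb: "\<exists>j\<in>Q - P. exchangeable F g P Q {k} {j}"
        if "distance P Q < distance X Y" "P \<in> F" "Q \<in> F" "k \<in> P" "k \<notin> Q" "card P \<le> card Q" for P Q k
        by (rule balanced_exchange_interval[OF E that(2,3) _ that(6,4,5)])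
           (rule IH, use that(1) in auto)
      show False
      proof (cases "A = {i}")
        case True
        have "card B \<noteq> 2"
        proof
          assume "card B = 2"
          then obtain k l where "Y - X = {k, l}" "k \<noteq> l" unfolding B_def card_2_iff by blast
          then show False using single_exchange_1_2[OF mult F] True neg unfolding A_def by blast
        qed
        then have B3: "card B \<ge> 3" using B2 by simp
        define W where "W = {w\<in>B. Y - {w} \<in> F}"
        have "\<exists>w\<in>Y - X. Y - {w} \<in> F"
          by (rule multiple_exchange_remove_element[OF mult F, of i])
             (use True B2 fin(4) in \<open>simp_all add: A_def B_def\<close>)
        then have "W \<noteq> {}" "finite W" using fin(4) unfolding B_def[symmetric] W_def by auto
        then obtain w where w: "w \<in> W" "\<And>u. u \<in> W \<Longrightarrow> g (Y - {u}) \<le> g (Y - {w})"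
          using finite_maximizer[of W "\<lambda>u. g (Y - {u})"] by blast
        have wB: "w \<in> B" "Y - {w} \<in> F" "w \<in> Y" "w \<notin> X" using w(1) unfolding W_def B_def by auto
        have "distance X (Y - {w}) \<le> card (A \<union> (B - {w}))"
          unfolding A_def B_def using fin wB by (intro distance_le) auto
        also have "\<dots> < distance X Y"
          unfolding dist using card_Un_le[of A "B - {w}"] card_Diff1_less[OF fin(4) wB(1)] by linarith
        finally have d: "distance X (Y - {w}) < distance X Y" .
        have cX: "card X = card (X \<inter> Y) + card A"
          unfolding A_def by (rule card_Int_Diff[OF fin(1)])
        have cY: "card Y = card (X \<inter> Y) + card B"
          unfolding B_def Int_commute[of X] by (rule card_Int_Diff[OF fin(2)])
        have "card X \<le> card (Y - {w})"
          using cX cY True B3 wB(3) fin(2) by simp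
        then obtain j where j: "j \<in> Y - {w} - X" "exchangeable F g X (Y - {w}) {i} {j}"
          using IHb[OF d F(1) wB(2), of i] i by blast
        define Q where "Q = Y - {w} - {j} \<union> {i}"
        have jB: "j \<in> B" "j \<noteq> w" using j(1) unfolding B_def by auto
        have Q: "X - {i} \<union> {j} \<in> F" "Q \<in> F" "g X + g (Y - {w}) \<le> g (X - {i} \<union> {j}) + g Q"
          using j(2) unfolding exchangeable_def Q_def by auto
        have gQ: "g (Y - {w}) < g Q" using gX[of "{j}"] Q jB by simp
        have "distance Y Q \<le> card {w, j, i}" unfolding Q_def by (intro distance_le) auto
        also have "\<dots> \<le> 3" using card_insert_le_m1[of 3 "{j, i}" w] card_insert_le_m1[of 2 "{i}" j] by simp
        also have "\<dots> < distance X Y" unfolding dist using B3 True by simp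
        finally have d: "distance Y Q < distance X Y" .
        have "w \<in> Y - Q" using wB i unfolding Q_def by auto
        then obtain J where J: "J \<subseteq> Q - Y" "exchangeable F g Y Q {w} J"
          using IH[OF d F(2) Q(2), of w] by blast
        have "Q - Y = {i}" using i unfolding Q_def by auto
        then consider "J = {}" | "J = {i}" using J(1) subset_singleton_iff by metis
        then show False
        proof cases
          case 1
          have "Q \<union> {w} = Y - {j} \<union> {i}" using wB jB unfolding Q_def by auto
          then have "Y - {j} \<union> {i} \<in> F" "g Y + g Q \<le> g (Y - {w}) + g (Y - {j} \<union> {i})"
            using J(2) 1 unfolding exchangeable_def by auto
          then show False using gY[of "{j}"] jB gQ by simp
        next
          case 2
          have "Q - {i} \<union> {w} = Y - {j}" using wB jB i unfolding Q_def B_def by auto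
          then have "Y - {w} \<union> {i} \<in> F" "Y - {j} \<in> F" "g Y + g Q \<le> g (Y - {w} \<union> {i}) + g (Y - {j})"
            using J(2) 2 unfolding exchangeable_def by auto
          moreover have "g (Y - {j}) \<le> g (Y - {w})" using w(2)[of j] jB \<open>Y - {j} \<in> F\<close> unfolding W_def by blast
          ultimately show False using gY[of "{w}"] wB gQ by simp
        qed
      next
        case False
        then obtain u where u: "u \<in> A" "u \<noteq> i" using AB by blast
        have A2: "card A \<ge> 2" using card_mono[OF fin(3), of "{u, i}"] u AB by simp
        have no22: "\<not> (card A = 2 \<and> card B = 2)"
        proof
          assume c: "card A = 2 \<and> card B = 2"
          then obtain k l where kl: "Y - X = {k, l}" "k \<noteq> l" unfolding B_def card_2_iff by blast
          have "card (A - {i}) = 1" using c fin AB by simp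
          then obtain j where "A - {i} = {j}" using card_1_singletonE by blast
          then have "X - Y = {i, j}" "i \<noteq> j" using AB unfolding A_def by auto
          then show False using single_exchange_2_2[OF mult F _ _ kl] neg by blast
        qed
        define S where "S = {V. V \<subseteq> B \<and> card V \<le> 1 \<and> Y - V \<union> {u} \<in> F}"
        have uXY: "u \<in> X" "u \<notin> Y" "u \<notin> B" using u AB by auto
        have "\<exists>V\<subseteq>Y - X. card V \<le> 1 \<and> Y - V \<union> {u} \<in> F"
          by (rule multiple_exchange_add_element[OF mult F fin(2)]) (use u in \<open>simp add: A_def\<close>)
        then have "S \<noteq> {}" unfolding S_def B_def by auto
        moreover have "finite S" using fin(4) unfolding S_def by simp
        ultimately obtain V where V: "V \<in> S" "\<And>V'. V' \<in> S \<Longrightarrow> g (Y - V' \<union> {u}) \<le> g (Y - V \<union> {u})"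
          using finite_maximizer[of S "\<lambda>V. g (Y - V \<union> {u})"] by blast
        define Q where "Q = Y - V \<union> {u}"
        have VB: "V \<subseteq> B" "card V \<le> 1" "Q \<in> F" using V(1) unfolding S_def Q_def by auto
        have finV: "finite V" using VB fin finite_subset by blast
        have "distance X Q \<le> card ((A - {u}) \<union> B)"
          unfolding Q_def A_def B_def using fin uXY VB(1) by (intro distance_le) (auto simp: B_def)
        also have "\<dots> < distance X Y"
          unfolding dist using card_Un_le[of "A - {u}" B] card_Diff1_less[OF fin(3) u(1)] by linarith
        finally have d: "distance X Q < distance X Y" .
        have "i \<in> X - Q" using i u(2) unfolding Q_def by auto
        then obtain J where J: "J \<subseteq> Q - X" "card J \<le> 1" "exchangeable F g X Q {i} J"
          using IH[OF d F(1) VB(3)] by blast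
        define R where "R = Q - J \<union> {i}"
        have QX: "Q - X = B - V" using uXY unfolding Q_def B_def by auto
        have JB: "J \<subseteq> B" "J \<inter> V = {}" using J(1) unfolding QX by auto
        have finJ: "finite J" using JB fin finite_subset by blast
        have R: "R \<in> F" "g Q < g R"
          using J(3) gX[OF JB(1) J(2)] unfolding exchangeable_def R_def by auto
        have R_eq: "R = Y - (V \<union> J) \<union> {u, i}" using JB uXY AB unfolding R_def Q_def by auto
        have cVJ: "card (V \<union> J) = card V + card J" using card_Un_disjoint[OF finV finJ] JB by blast
        have VJB: "V \<union> J \<subseteq> B" using VB JB by blast
        have RY: "R - Y = {u, i}" "Y - R = V \<union> J" using VJB uXY i unfolding R_eq B_def by auto
        have dR: "distance R Y \<le> 2 + card (V \<union> J)"
        proof -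
          have "distance R Y \<le> card ({u, i} \<union> (V \<union> J))"
            using RY finV finJ by (intro distance_le) auto
          also have "\<dots> \<le> card {u, i} + card (V \<union> J)" by (rule card_Un_le)
          finally show ?thesis using u by simp
        qed
        have iR: "i \<in> R" "i \<notin> Y" using i unfolding R_eq by auto
        \<comment> \<open>The elements of Y missing in R are shared between the two resulting sets, at most one in each.
          If there are two of them, R is no larger than Y and balanced exchange applies.\<close>
        have "\<exists>J'\<subseteq>V \<union> J. card J' \<le> 1 \<and> card (V \<union> J - J') \<le> 1 \<and> exchangeable F g R Y {i} J'"
        proof (cases "card (V \<union> J) \<le> 1")
          case True
          then have "distance R Y < distance X Y" using dR A2 B2 unfolding dist by linarith
          then obtain J' where "J' \<subseteq> Y - R" "card J' \<le> 1" "exchangeable F g R Y {i} J'"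
            using IH[OF _ R(1) F(2), of i] iR by blast
          moreover have "card (V \<union> J - J') \<le> 1"
            using card_mono[of "V \<union> J" "V \<union> J - J'"] finV finJ True by auto
          ultimately show ?thesis using RY(2) by blast
        next
          case False
          then have c2: "card (V \<union> J) = 2" using cVJ VB(2) J(2) by linarith
          then have d: "distance R Y < distance X Y" using dR A2 B2 no22 unfolding dist by linarith
          have "V \<union> J \<subseteq> Y" using VJB AB by blast
          then have "card (Y - (V \<union> J)) + 2 = card Y"
            using c2 card_Int_Diff[OF fin(2), of "V \<union> J"] by (simp add: Int_absorb1)
          moreover have "card R = card (Y - (V \<union> J)) + 2"
            unfolding R_eq using uXY i u fin by (subst card_Un_disjoint) auto
          ultimately have "card R \<le> card Y" by simp
          then obtain j where j: "j \<in> Y - R" "exchangeable F g R Y {i} {j}"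
            using IHb[OF d R(1) F(2) iR] by blast
          have "card (V \<union> J - {j}) \<le> 1" using j(1) c2 finV finJ unfolding RY(2) by simp
          then show ?thesis using j RY(2) by (intro exI[of _ "{j}"]) auto
        qed
        then obtain J' where J': "J' \<subseteq> V \<union> J" "card J' \<le> 1" "card (V \<union> J - J') \<le> 1"
          "exchangeable F g R Y {i} J'" by blast
        have "R - {i} \<union> J' = Y - (V \<union> J - J') \<union> {u}"
          using J'(1) VJB uXY i u unfolding R_eq B_def by auto
        then have *: "Y - (V \<union> J - J') \<union> {u} \<in> F" "Y - J' \<union> {i} \<in> F"
          "g R + g Y \<le> g (Y - (V \<union> J - J') \<union> {u}) + g (Y - J' \<union> {i})"
          using J'(4) unfolding exchangeable_def by auto
        have "V \<union> J - J' \<in> S" using *(1) J'(3) VJB unfolding S_def by auto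
        then have "g (Y - (V \<union> J - J') \<union> {u}) \<le> g Q" unfolding Q_def by (rule V(2))
        moreover have "g (Y - J' \<union> {i}) < g Y" using gY[of J'] J' VJB *(2) by auto
        ultimately show False using *(3) R(2) by linarith
      qed
    qed
  qed
  then show ?thesis unfolding single_exchange_def by blast
qed

section \<open>Minimizing a maximum of affine functions\<close>

text \<open>
  One step of Fourier-Motzkin elimination. A line of positive slope bounds \<open>t\<close> from above, one of
  negative slope from below; the expression in \<open>cross\<close> is the height at which the two lines meet.
\<close>
lemma affine_lines_common_point:
  fixes K :: "'k set" and a e :: "'k \<Rightarrow> real"
  assumes fin: "finite K"
    and zero: "\<And>k. k \<in> K \<Longrightarrow> e k = 0 \<Longrightarrow> a k \<le> M"
    and cross: "\<And>k l. k \<in> K \<Longrightarrow> l \<in> K \<Longrightarrow> e k > 0 \<Longrightarrow> e l < 0 \<Longrightarrow>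
      (a k * (- e l) + a l * e k) / (e k - e l) \<le> M"
  shows "\<exists>t. \<forall>k\<in>K. a k + e k * t \<le> M"
proof -
  define U where "U = (\<lambda>k. (M - a k) / e k) ` {k \<in> K. e k > 0}"
  define L where "L = (\<lambda>k. (M - a k) / e k) ` {k \<in> K. e k < 0}"
  have fin': "finite U" "finite L" using fin unfolding U_def L_def by auto
  have LU: "x \<le> y" if "x \<in> L" "y \<in> U" for x y
  proof -
    obtain k where k: "k \<in> K" "e k > 0" "y = (M - a k) / e k" using \<open>y \<in> U\<close> unfolding U_def by auto
    obtain l where l: "l \<in> K" "e l < 0" "x = (M - a l) / e l" using \<open>x \<in> L\<close> unfolding L_def by auto
    have "a k * (- e l) + a l * e k \<le> M * (e k - e l)"
      using cross[OF k(1) l(1) k(2) l(2)] k(2) l(2) by (simp add: divide_le_eq)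
    then have "(M - a k) * e l \<le> (M - a l) * e k" by (simp add: algebra_simps)
    then show ?thesis unfolding k(3) l(3) using k(2) l(2)
      by (simp add: divide_simps mult.commute)
  qed
  obtain t where t: "\<And>x. x \<in> L \<Longrightarrow> x \<le> t" "\<And>y. y \<in> U \<Longrightarrow> t \<le> y"
  proof (cases "L = {}")
    case False
    show ?thesis by (rule that[of "Max L"]) (use False fin' LU in auto)
  next
    case L: True
    show ?thesis
    proof (cases "U = {}")
      case True then show ?thesis using that L by blast
    next
      case False
      show ?thesis by (rule that[of "Min U"]) (use L False fin' in auto)
    qed
  qed
  have "a k + e k * t \<le> M" if "k \<in> K" for k
  proof -
    consider "e k = 0" | "e k > 0" | "e k < 0" by linarith
    then show ?thesis
    proof cases
      case 1 then show ?thesis using zero[OF that] by simp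
    next
      case 2
      then have "t \<le> (M - a k) / e k" using that t(2) unfolding U_def by auto
      then show ?thesis using 2 by (simp add: field_simps)
    next
      case 3
      then have "(M - a k) / e k \<le> t" using that t(1) unfolding L_def by auto
      then show ?thesis using 3 by (simp add: field_simps)
    qed
  qed
  then show ?thesis by blast
qed

text \<open>
  A pair \<open>(a, e)\<close> stands for the affine function \<open>p \<mapsto> a + (\<Sum>w\<in>W. e w * p w)\<close>. Minimizing over the
  coordinate \<open>w\<close> first replaces the functions that depend on it by the combinations \<open>comb\<close> of one
  that increases and one that decreases in it, and the maximum of the new functions is the partial
  minimum of the old maximum.
\<close>
lemma max_affine_attains_minimum:
  fixes K :: "(real \<times> ('w \<Rightarrow> real)) set"
  assumes "finite W" "finite K" "K \<noteq> {}"
    and "\<And>p. \<exists>(a, e)\<in>K. c \<le> a + (\<Sum>w\<in>W. e w * p w)"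
  shows "\<exists>p. \<forall>q. \<exists>(a, e)\<in>K. \<forall>(b, d)\<in>K. b + (\<Sum>w\<in>W. d w * p w) \<le> a + (\<Sum>w\<in>W. e w * q w)"
  using assms
proof (induction W arbitrary: K rule: finite_induct)
  case empty
  then obtain k where "k \<in> K" "\<And>l. l \<in> K \<Longrightarrow> fst l \<le> fst k"
    using finite_maximizer[of K fst] by blast
  then show ?case by (fastforce simp: case_prod_beta)
next
  case (insert w W)
  define comb :: "_ \<Rightarrow> real \<times> ('w \<Rightarrow> real)" where
    "comb = (\<lambda>(k, l). ((fst k * (- snd l w) + fst l * snd k w) / (snd k w - snd l w),
      \<lambda>x. (snd k x * (- snd l w) + snd l x * snd k w) / (snd k w - snd l w)))"
  define K0 where "K0 = {k \<in> K. snd k w = 0}"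
  define P where "P = {k \<in> K. snd k w > 0}"
  define N where "N = {k \<in> K. snd k w < 0}"
  define K' where "K' = K0 \<union> comb ` (P \<times> N)"
  define val where "val k p = fst k + (\<Sum>x\<in>W. snd k x * p x)" for k :: "real \<times> ('w \<Rightarrow> real)" and p
  have valK: "fst k + (\<Sum>x\<in>insert w W. snd k x * (p(w := t)) x) = val k p + snd k w * t" for k p t
  proof -
    have "(\<Sum>x\<in>W. snd k x * (p(w := t)) x) = (\<Sum>x\<in>W. snd k x * p x)"
      using insert.hyps by (intro sum.cong) auto
    then show ?thesis using insert.hyps unfolding val_def by simp
  qed
  have val_comb: "val (comb (k, l)) p = (val k p * (- snd l w) + val l p * snd k w) / (snd k w - snd l w)" for k l p
  proof -
    have "(\<Sum>x\<in>W. (snd k x * (- snd l w) + snd l x * snd k w) / (snd k w - snd l w) * p x)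
      = ((\<Sum>x\<in>W. snd k x * p x) * (- snd l w) + (\<Sum>x\<in>W. snd l x * p x) * snd k w) / (snd k w - snd l w)"
      unfolding sum_distrib_right sum.distrib[symmetric] sum_divide_distrib
      by (intro sum.cong) (auto simp: algebra_simps)
    then show ?thesis unfolding val_def comb_def
      by (simp add: add_divide_distrib[symmetric] algebra_simps)
  qed
  have comb_le: "val k' p \<le> M"
    if "k' \<in> K'" "\<And>k. k \<in> K \<Longrightarrow> val k p + snd k w * t \<le> M" for k' p t M
  proof (cases "k' \<in> K0")
    case True
    then show ?thesis using that(2)[of k'] unfolding K0_def by simp
  next
    case False
    then obtain k l where kl: "k' = comb (k, l)" "k \<in> P" "l \<in> N" using \<open>k' \<in> K'\<close> unfolding K'_def by auto
    have s: "snd k w > 0" "snd l w < 0" "k \<in> K" "l \<in> K" using kl unfolding P_def N_def by auto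
    have "(val k p + snd k w * t) * (- snd l w) \<le> M * (- snd l w)"
      using that(2)[OF s(3)] s by (intro mult_right_mono) auto
    moreover have "(val l p + snd l w * t) * snd k w \<le> M * snd k w"
      using that(2)[OF s(4)] s by (intro mult_right_mono) auto
    ultimately have "val k p * (- snd l w) + val l p * snd k w \<le> M * (snd k w - snd l w)"
      by (simp add: algebra_simps)
    then show ?thesis unfolding kl(1) val_comb using s by (simp add: divide_le_eq)
  qed
  have below: "\<exists>t. \<forall>k\<in>K. val k p + snd k w * t \<le> M" if "\<And>k'. k' \<in> K' \<Longrightarrow> val k' p \<le> M" for p M
  proof (rule affine_lines_common_point[OF insert.prems(1)])
    fix k assume "k \<in> K" "snd k w = 0"
    then show "val k p \<le> M" using that unfolding K'_def K0_def by blast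
  next
    fix k l assume "k \<in> K" "l \<in> K" "snd k w > 0" "snd l w < 0"
    then have "comb (k, l) \<in> K'" unfolding K'_def P_def N_def by blast
    then show "(val k p * (- snd l w) + val l p * snd k w) / (snd k w - snd l w) \<le> M"
      using that val_comb by metis
  qed
  have bound: "\<exists>k\<in>K. c \<le> val k p + snd k w * t" for p t
    using insert.prems(3)[of "p(w := t)"] valK[of _ p t] by (force simp: case_prod_beta)
  have finK': "finite K'" using insert.prems(1) unfolding K'_def K0_def P_def N_def by auto
  have "K' \<noteq> {}"
  proof
    assume "K' = {}"
    then obtain t where t: "\<forall>k\<in>K. val k (\<lambda>_. 0) + snd k w * t \<le> c - 1" using below[of _ "c - 1"] by blast
    obtain k where "k \<in> K" "c \<le> val k (\<lambda>_. 0) + snd k w * t" using bound[of "\<lambda>_. 0" t] by blast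
    then show False using t by force
  qed
  moreover have "\<exists>(a, e)\<in>K'. c \<le> a + (\<Sum>x\<in>W. e x * p x)" for p
  proof -
    obtain m where m: "m \<in> K'" "\<And>k. k \<in> K' \<Longrightarrow> val k p \<le> val m p"
      using finite_maximizer[OF finK' \<open>K' \<noteq> {}\<close>, of "\<lambda>k. val k p"] by blast
    obtain t where t: "\<forall>k\<in>K. val k p + snd k w * t \<le> val m p" using below[OF m(2)] by blast
    obtain k where "k \<in> K" "c \<le> val k p + snd k w * t" using bound[of p t] by blast
    then have "c \<le> val m p" using t by force
    then show ?thesis using m(1) unfolding val_def by (auto simp: case_prod_beta)
  qed
  ultimately obtain p where p: "\<And>q. \<exists>k\<in>K'. \<forall>l\<in>K'. val l p \<le> val k q"
    using insert.IH[OF finK'] unfolding val_def case_prod_beta by blast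
  obtain m where m: "m \<in> K'" "\<And>k. k \<in> K' \<Longrightarrow> val k p \<le> val m p"
    using finite_maximizer[OF finK' \<open>K' \<noteq> {}\<close>, of "\<lambda>k. val k p"] by blast
  obtain t where t: "\<forall>k\<in>K. val k p + snd k w * t \<le> val m p" using below[OF m(2)] by blast
  have opt: "\<exists>k\<in>K. \<forall>l\<in>K. val l p + snd l w * t \<le> val k q + snd k w * q w" for q
  proof -
    obtain k where k: "k \<in> K" "\<And>l. l \<in> K \<Longrightarrow> val l q + snd l w * q w \<le> val k q + snd k w * q w"
      using finite_maximizer[OF insert.prems(1,2), of "\<lambda>k. val k q + snd k w * q w"] by blast
    obtain k' where k': "k' \<in> K'" "val m p \<le> val k' q" using p[of q] m(1) by blast
    have "val k' q \<le> val k q + snd k w * q w" using comb_le[OF k'(1) k(2)] by blast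
    then show ?thesis using k(1) k'(2) t by force
  qed
  then have "\<exists>k\<in>K. \<forall>l\<in>K. fst l + (\<Sum>x\<in>insert w W. snd l x * (p(w := t)) x)
      \<le> fst k + (\<Sum>x\<in>insert w W. snd k x * q x)" for q
  proof -
    have "fst k + (\<Sum>x\<in>insert w W. snd k x * q x) = val k q + snd k w * q w" for k
      using valK[of k q "q w"] by simp
    then show ?thesis unfolding valK using opt[of q] by simp
  qed
  then show ?case by (intro exI[of _ "p(w := t)"]) (auto simp: case_prod_beta)
qed

section \<open>Matroid intersection\<close>

definition rank_function :: "'w set \<Rightarrow> ('w set \<Rightarrow> nat) \<Rightarrow> bool" where
  "rank_function W r \<longleftrightarrow>
     (\<forall>T\<subseteq>W. r T \<le> card T) \<and>
     (\<forall>S T. S \<subseteq> T \<longrightarrow> T \<subseteq> W \<longrightarrow> r S \<le> r T) \<and>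
     (\<forall>S\<subseteq>W. \<forall>T\<subseteq>W. r (S \<union> T) + r (S \<inter> T) \<le> r S + r T)"

lemma rank_functionD:
  assumes "rank_function W r"
  shows "T \<subseteq> W \<Longrightarrow> r T \<le> card T"
    and "S \<subseteq> T \<Longrightarrow> T \<subseteq> W \<Longrightarrow> r S \<le> r T"
    and "S \<subseteq> W \<Longrightarrow> T \<subseteq> W \<Longrightarrow> r (S \<union> T) + r (S \<inter> T) \<le> r S + r T"
  using assms unfolding rank_function_def by simp_all

lemma rank_function_delete:
  assumes "rank_function (insert w W) r" shows "rank_function W r"
  using rank_functionD[OF assms] unfolding rank_function_def by (meson order_trans subset_insertI)

lemma rank_function_loop:
  assumes r: "rank_function W r" and "T \<subseteq> W" "w \<in> W" "r {w} = 0"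
  shows "r (insert w T) = r T"
proof -
  have "r (T \<union> {w}) + r (T \<inter> {w}) \<le> r T + r {w}" using rank_functionD(3)[OF r] assms by blast
  moreover have "r T \<le> r (insert w T)" using rank_functionD(2)[OF r] assms by blast
  ultimately show ?thesis using assms(4) by simp
qed

lemma rank_function_contract:
  assumes r: "rank_function (insert w W) r" and w: "w \<notin> W" "r {w} = 1" and fin: "finite W"
  shows "rank_function W (\<lambda>T. r (insert w T) - 1)"
proof -
  have pos: "1 \<le> r (insert w T)" if "T \<subseteq> W" for T
    using rank_functionD(2)[OF r _ insert_mono[OF that], of "{w}"] w by simp
  have "r (insert w T) - 1 \<le> card T" if "T \<subseteq> W" for T
  proof -
    have "card (insert w T) = Suc (card T)" using that w fin finite_subset by (subst card_insert_disjoint) auto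
    then show ?thesis using rank_functionD(1)[OF r insert_mono[OF that]] by simp
  qed
  moreover have "r (insert w S) - 1 \<le> r (insert w T) - 1" if "S \<subseteq> T" "T \<subseteq> W" for S T
    by (intro diff_le_mono rank_functionD(2)[OF r]) (use that in auto)
  moreover have "r (insert w (S \<union> T)) - 1 + (r (insert w (S \<inter> T)) - 1)
      \<le> r (insert w S) - 1 + (r (insert w T) - 1)" if "S \<subseteq> W" "T \<subseteq> W" for S T
  proof -
    have "insert w S \<union> insert w T = insert w (S \<union> T)" "insert w S \<inter> insert w T = insert w (S \<inter> T)" by auto
    then have "r (insert w (S \<union> T)) + r (insert w (S \<inter> T)) \<le> r (insert w S) + r (insert w T)"
      using rank_functionD(3)[OF r insert_mono insert_mono, OF that] by simp
    moreover have "1 \<le> r (insert w (S \<union> T))" "1 \<le> r (insert w (S \<inter> T))" using that by (intro pos; blast)+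
    ultimately show ?thesis by linarith
  qed
  ultimately show ?thesis unfolding rank_function_def by blast
qed

text \<open>
  The nontrivial half of the matroid intersection theorem, in terms of rank functions: \<open>S\<close> is
  independent iff \<open>r S = card S\<close>. Delete an element \<open>w\<close>. If the covering condition fails for some
  \<open>T\<close>, then contract \<open>w\<close> and look for a set of size \<open>k - 1\<close>: were the condition to fail there too, for
  some \<open>V\<close>, submodularity applied to \<open>T\<close> and \<open>insert w V\<close> would give two covers of total value less
  than \<open>2 k\<close>.
\<close>
lemma common_independent_set:
  assumes "finite W" "rank_function W r" "rank_function W s"
    and "\<And>T. T \<subseteq> W \<Longrightarrow> k \<le> r T + s (W - T)"
  shows "\<exists>S\<subseteq>W. card S = k \<and> r S = k \<and> s S = k"
  using assms
proof (induction W arbitrary: r s k rule: finite_induct)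
  case empty
  have "r {} = 0" "s {} = 0" using rank_functionD(1)[of "{}" r "{}"] rank_functionD(1)[of "{}" s "{}"] empty by auto
  then show ?case using empty(3)[of "{}"] by simp
next
  case (insert w W)
  note r = insert.prems(1) and s = insert.prems(2) and cover = insert.prems(3)
  have Diffs: "insert w W - T = insert w (W - T)" "insert w W - insert w T = W - T" if "T \<subseteq> W" for T
    using that insert.hyps by auto
  have cover0: "k \<le> r T + s (insert w (W - T))" if "T \<subseteq> W" for T
    using cover[of T] Diffs(1)[OF that] that by auto
  have cover1: "k \<le> r (insert w T) + s (W - T)" if "T \<subseteq> W" for T
    using cover[of "insert w T"] Diffs(2)[OF that] that by auto
  show ?case
  proof (cases "\<forall>T\<subseteq>W. k \<le> r T + s (W - T)")
    case True
    have "\<exists>S\<subseteq>W. card S = k \<and> r S = k \<and> s S = k"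
      by (rule insert.IH[OF rank_function_delete[OF r] rank_function_delete[OF s]]) (use True in simp)
    then show ?thesis by blast
  next
    case False
    then obtain T where T: "T \<subseteq> W" "r T + s (W - T) < k" by force
    have "r {w} \<noteq> 0" using rank_function_loop[OF r, of T w] cover1[OF T(1)] T by auto
    moreover have "s {w} \<noteq> 0" using rank_function_loop[OF s, of "W - T" w] cover0[OF T(1)] T by auto
    moreover have "r {w} \<le> 1" "s {w} \<le> 1" using rank_functionD(1)[OF r, of "{w}"] rank_functionD(1)[OF s, of "{w}"] by auto
    ultimately have w: "r {w} = 1" "s {w} = 1" by auto
    have pos: "1 \<le> r (insert w V)" "1 \<le> s (insert w V)" if "V \<subseteq> W" for V
      using rank_functionD(2)[OF r _ insert_mono[OF that], of "{w}"]
        rank_functionD(2)[OF s _ insert_mono[OF that], of "{w}"] w by simp_all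
    have cover': "k - 1 \<le> (r (insert w V) - 1) + (s (insert w (W - V)) - 1)" if V: "V \<subseteq> W" for V
    proof -
      have "r (insert w V \<union> T) + r (insert w V \<inter> T) \<le> r (insert w V) + r T"
        using T V by (intro rank_functionD(3)[OF r]) auto
      moreover have "insert w V \<union> T = insert w (V \<union> T)" "insert w V \<inter> T = V \<inter> T"
        using T(1) insert.hyps by auto
      moreover have "s (insert w (W - V) \<union> (W - T)) + s (insert w (W - V) \<inter> (W - T))
          \<le> s (insert w (W - V)) + s (W - T)"
        using T V by (intro rank_functionD(3)[OF s]) auto
      moreover have "insert w (W - V) \<union> (W - T) = insert w (W - V \<inter> T)"
        "insert w (W - V) \<inter> (W - T) = W - (V \<union> T)"
        using T(1) insert.hyps by auto
      moreover have "k \<le> r (insert w (V \<union> T)) + s (W - (V \<union> T))"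
        using T V by (intro cover1) auto
      moreover have "k \<le> r (V \<inter> T) + s (insert w (W - V \<inter> T))"
        using T V by (intro cover0) auto
      moreover have "1 \<le> r (insert w V)" "1 \<le> s (insert w (W - V))"
        using pos(1)[OF V] pos(2)[of "W - V"] by auto
      ultimately show ?thesis using T(2) by simp
    qed
    have "\<exists>S\<subseteq>W. card S = k - 1 \<and> r (insert w S) - 1 = k - 1 \<and> s (insert w S) - 1 = k - 1"
      by (rule insert.IH[OF rank_function_contract[OF r insert.hyps(2) w(1) insert.hyps(1)]
          rank_function_contract[OF s insert.hyps(2) w(2) insert.hyps(1)]]) (rule cover')
    then obtain S where S: "S \<subseteq> W" "card S = k - 1" "r (insert w S) - 1 = k - 1" "s (insert w S) - 1 = k - 1"
      by blast
    have "w \<notin> S" "finite S" using S(1) insert.hyps finite_subset by auto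
    then have "card (insert w S) = k" using S(2) T(2) by simp
    moreover have "r (insert w S) = k" "s (insert w S) = k" using S pos[OF S(1)] T(2) by auto
    ultimately show ?thesis using S(1) by (intro exI[of _ "insert w S"]) auto
  qed
qed

section \<open>Relaxed multiple exchange\<close>

text \<open>
  An exchange between comparable sets cannot be compensated, so it moves a single element.
\<close>
lemma single_exchange_between:
  assumes ex: "single_exchange F v" and F: "A \<in> F" "B \<in> F" and "B \<subseteq> A" "finite I" "I \<subseteq> A - B"
  shows "B \<union> I \<in> F"
  using assms(5,6)
proof (induction I rule: finite_induct)
  case (insert i I)
  have i: "i \<in> A" "i \<notin> B \<union> I" and I: "B \<union> I \<in> F" using insert by auto
  obtain J where J: "J \<subseteq> (B \<union> I) - A" "card J \<le> 1" "A - {i} \<union> J \<in> F" "insert i (B \<union> I - J) \<in> F"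
    "v A + v (B \<union> I) \<le> v (A - {i} \<union> J) + v (insert i (B \<union> I - J))"
    by (rule single_exchangeE[OF ex F(1) I i])
  have "J = {}" using J(1) insert.prems \<open>B \<subseteq> A\<close> by auto
  then show ?case using J(4) by simp
qed (use F in simp)

text \<open>
  Submodularity for comparable sets. For \<open>insert i I\<close> it is the sum of a single exchange of \<open>i\<close>
  between \<open>A\<close> and \<open>B \<union> I\<close> and the inequality for \<open>A - {i}\<close>, \<open>B\<close> and \<open>I\<close>; the common terms
  cancel because the sets between \<open>B\<close> and \<open>A\<close> lie in \<open>F\<close>.
\<close>
lemma single_exchange_nested:
  assumes ex: "single_exchange F v" and F: "A \<in> F" "B \<in> F" and "B \<subseteq> A" "finite A" "I \<subseteq> A - B"
  shows "exchangeable F v A B I {}"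
proof -
  have "finite I" using assms finite_subset by blast
  then have "v A + v B \<le> v (A - I) + v (B \<union> I)" using F(1) assms(4-6)
  proof (induction I arbitrary: A rule: finite_induct)
    case (insert i I)
    have BI: "B \<union> I \<in> F" using single_exchange_between[OF ex insert.prems(1) F(2)] insert by blast
    have i: "i \<in> A" "i \<notin> B \<union> I" using insert by auto
    obtain J where J: "J \<subseteq> (B \<union> I) - A" "card J \<le> 1" "A - {i} \<union> J \<in> F" "insert i (B \<union> I - J) \<in> F"
      "v A + v (B \<union> I) \<le> v (A - {i} \<union> J) + v (insert i (B \<union> I - J))"
      by (rule single_exchangeE[OF ex insert.prems(1) BI i])
    have J0: "J = {}" using J(1) insert.prems by auto
    have "v (A - {i}) + v B \<le> v (A - {i} - I) + v (B \<union> I)"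
      using J(3) J0 insert.prems insert.hyps by (intro insert.IH) auto
    moreover have "A - {i} - I = A - insert i I" "insert i (B \<union> I) = B \<union> insert i I" by auto
    ultimately show ?case using J(5) J0 by simp
  qed simp
  moreover have "B \<union> I \<in> F"
    using single_exchange_between[OF ex F assms(4) \<open>finite I\<close> assms(6)] .
  moreover have "A - I = B \<union> (A - B - I)" using assms by auto
  moreover have "B \<union> (A - B - I) \<in> F"
    using single_exchange_between[OF ex F assms(4), of "A - B - I"] assms(5) by auto
  ultimately show ?thesis unfolding exchangeable_def by simp
qed

text \<open>
  The best completion by elements of \<open>W\<close>, as a function of the elements outside \<open>W\<close>. A compensation
  inside \<open>W\<close> becomes invisible, that is, an exchange without compensation.
\<close>
lemma single_exchange_projection:
  fixes v :: "'a set \<Rightarrow> real" and W :: "'a set"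
  assumes fin: "finite F" "\<And>Z. Z \<in> F \<Longrightarrow> finite Z" and ex: "single_exchange F v"
  obtains h where "single_exchange ((\<lambda>Z. Z - W) ` F) h"
    and "\<forall>S\<in>(\<lambda>Z. Z - W) ` F. \<exists>Z\<in>F. Z - W = S \<and> v Z = h S"
    and "\<forall>Z\<in>F. v Z \<le> h (Z - W)"
proof -
  define h where "h S = Max (v ` {Z \<in> F. Z - W = S})" for S
  have attained: "\<exists>Z\<in>F. Z - W = S \<and> v Z = h S" if "S \<in> (\<lambda>Z. Z - W) ` F" for S
  proof -
    have "h S \<in> v ` {Z \<in> F. Z - W = S}"
      unfolding h_def using that fin by (intro Max_in) auto
    then obtain Z where "Z \<in> {Z \<in> F. Z - W = S}" "h S = v Z" by (rule imageE)
    then show ?thesis by (intro bexI[of _ Z]) simp_all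
  qed
  have le: "v Z \<le> h (Z - W)" if "Z \<in> F" for Z
    unfolding h_def using that fin by (intro Max_ge) auto
  have "single_exchange ((\<lambda>Z. Z - W) ` F) h"
    unfolding single_exchange_def
  proof (intro ballI)
    fix S T i assume S: "S \<in> (\<lambda>Z. Z - W) ` F" and T: "T \<in> (\<lambda>Z. Z - W) ` F" and i: "i \<in> S - T"
    obtain P where P: "P \<in> F" "P - W = S" "v P = h S" using attained[OF S] by blast
    obtain Q where Q: "Q \<in> F" "Q - W = T" "v Q = h T" using attained[OF T] by blast
    have iPQ: "i \<in> P" "i \<notin> Q" "i \<notin> W" using i P(2) Q(2) by auto
    obtain J where J: "J \<subseteq> Q - P" "card J \<le> 1" "P - {i} \<union> J \<in> F" "insert i (Q - J) \<in> F"
      "v P + v Q \<le> v (P - {i} \<union> J) + v (insert i (Q - J))"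
      by (rule single_exchangeE[OF ex P(1) Q(1) iPQ(1,2)])
    have eq: "P - {i} \<union> J - W = S - {i} \<union> (J - W)" "insert i (Q - J) - W = T - (J - W) \<union> {i}"
      using P(2) Q(2) iPQ by auto
    have "S - {i} \<union> (J - W) \<in> (\<lambda>Z. Z - W) ` F" "T - (J - W) \<union> {i} \<in> (\<lambda>Z. Z - W) ` F"
      using J(3,4) eq by (metis imageI)+
    moreover have "h S + h T \<le> h (S - {i} \<union> (J - W)) + h (T - (J - W) \<union> {i})"
      using J(5) le[OF J(3)] le[OF J(4)] P(3) Q(3) unfolding eq by linarith
    ultimately have "exchangeable ((\<lambda>Z. Z - W) ` F) h S T {i} (J - W)"
      unfolding exchangeable_def by simp
    moreover have "J - W \<subseteq> T - S" using J(1) P(2) Q(2) by auto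
    moreover have "card (J - W) \<le> 1"
    proof -
      have "finite J" using J(1) fin(2)[OF Q(1)] finite_subset by blast
      then show ?thesis using J(2) card_mono[of J "J - W"] by auto
    qed
    ultimately show "\<exists>J\<subseteq>T - S. card J \<le> 1 \<and> exchangeable ((\<lambda>Z. Z - W) ` F) h S T {i} J" by blast
  qed
  then show ?thesis using attained le by (intro that) auto
qed

text \<open>
  The multiple exchange in which \<open>X\<close> may receive a set \<open>J\<close> different from the set \<open>K\<close> that \<open>Y\<close> gives
  away, the difference being charged at arbitrary prices \<open>p\<close>. It is submodularity between \<open>X\<close> and
  \<open>X \<inter> Y\<close> for the function projected along \<open>Y - X\<close>.
\<close>
lemma relaxed_multiple_exchange:
  assumes E: "finite E" "F \<subseteq> Pow E" and ex: "single_exchange F v"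
    and F: "X \<in> F" "Y \<in> F" and I: "I \<subseteq> X - Y"
  shows "\<exists>J K. J \<subseteq> Y - X \<and> K \<subseteq> Y - X \<and> X - I \<union> J \<in> F \<and> Y - K \<union> I \<in> F \<and>
    v X + v Y + sum p K \<le> v (X - I \<union> J) + sum p J + v (Y - K \<union> I)"
proof -
  have finF: "finite Z" if "Z \<in> F" for Z using that E finite_subset by blast
  have "finite F" using E by (simp add: finite_subset)
  define g where "g Z = v Z + sum p Z" for Z
  have exg: "single_exchange F g" using single_exchange_add_sum[OF ex finF, of p] unfolding g_def by simp
  define W where "W = Y - X"
  define H where "H = (\<lambda>Z. Z - W) ` F"
  obtain h where h: "single_exchange H h" "\<forall>S\<in>H. \<exists>Z\<in>F. Z - W = S \<and> g Z = h S"
    "\<forall>Z\<in>F. g Z \<le> h (Z - W)"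
    unfolding H_def by (rule single_exchange_projection[OF \<open>finite F\<close> finF exg, where W = W])
  have proj: "X - W = X" "Y - W = X \<inter> Y" unfolding W_def by auto
  have "X \<in> H" "X \<inter> Y \<in> H" unfolding H_def using F proj by (metis imageI)+
  then have "exchangeable H h X (X \<inter> Y) I {}"
    using I finF[OF F(1)] by (intro single_exchange_nested[OF h(1)]) auto
  then have nest: "X - I \<in> H" "X \<inter> Y \<union> I \<in> H" "h X + h (X \<inter> Y) \<le> h (X - I) + h (X \<inter> Y \<union> I)"
    unfolding exchangeable_def by auto
  obtain P where P: "P \<in> F" "P - W = X - I" "g P = h (X - I)" using h(2) nest(1) by blast
  obtain Q where Q: "Q \<in> F" "Q - W = X \<inter> Y \<union> I" "g Q = h (X \<inter> Y \<union> I)" using h(2) nest(2) by blast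
  define J where "J = P \<inter> W"
  define K where "K = W - Q"
  have PJ: "P = X - I \<union> J" using P(2) unfolding J_def by auto
  have QK: "Q = Y - K \<union> I" using Q(2) I unfolding K_def W_def by blast
  have JK: "J \<subseteq> Y - X" "K \<subseteq> Y - X" unfolding J_def K_def W_def by auto
  have fin: "finite X" "finite Y" "finite I" "finite J" "finite K"
    using finF F I JK finite_subset by (auto intro: finite_subset)
  have IX: "I \<subseteq> X" "K \<subseteq> Y" using I JK by auto
  have "sum p P = sum p X - sum p I + sum p J"
    unfolding PJ using fin JK sum_diff[OF fin(1) IX(1), of p] by (subst sum.union_disjoint) auto
  moreover have "sum p Q = sum p Y - sum p K + sum p I"
    unfolding QK using fin I sum_diff[OF fin(2) IX(2), of p] by (subst sum.union_disjoint) auto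
  moreover have "g X + g Y \<le> g P + g Q"
    using bspec[OF h(3) F(1)] bspec[OF h(3) F(2)] nest(3) P(3) Q(3) proj by simp
  ultimately have "v X + v Y + sum p K \<le> v (X - I \<union> J) + sum p J + v (Y - K \<union> I)"
    unfolding g_def PJ[symmetric] QK[symmetric] by linarith
  then show ?thesis using JK P(1) Q(1) PJ QK by blast
qed

section \<open>Multiple exchange in valuated matroids\<close>

text \<open>
  The exchange property of valuated matroids. With \<open>v\<close> constant it is the symmetric exchange property of
  the bases of a matroid.
\<close>
definition basis_exchange :: "'a set set \<Rightarrow> ('a set \<Rightarrow> real) \<Rightarrow> bool" where
  "basis_exchange F v \<longleftrightarrow>
     (\<forall>X\<in>F. \<forall>Y\<in>F. \<forall>i\<in>X - Y. \<exists>j\<in>Y - X. exchangeable F v X Y {i} {j})"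

lemma basis_exchangeE:
  assumes "basis_exchange F v" "X \<in> F" "Y \<in> F" "i \<in> X" "i \<notin> Y"
  obtains j where "j \<in> Y" "j \<notin> X" "insert j (X - {i}) \<in> F" "insert i (Y - {j}) \<in> F"
    "v X + v Y \<le> v (insert j (X - {i})) + v (insert i (Y - {j}))"
proof -
  obtain j where "j \<in> Y - X" "exchangeable F v X Y {i} {j}"
    using assms unfolding basis_exchange_def by (meson DiffI)
  then show ?thesis using that[of j] unfolding exchangeable_def by simp
qed

lemma basis_imp_single_exchange:
  assumes "basis_exchange F v" shows "single_exchange F v"
  unfolding single_exchange_def
proof (intro ballI)
  fix X Y i assume "X \<in> F" "Y \<in> F" "i \<in> X - Y"
  then obtain j where "j \<in> Y - X" "exchangeable F v X Y {i} {j}"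
    using assms unfolding basis_exchange_def by meson
  then show "\<exists>J\<subseteq>Y - X. card J \<le> 1 \<and> exchangeable F v X Y {i} J"
    by (intro exI[of _ "{j}"]) auto
qed

lemma basis_exchange_add_sum:
  assumes "basis_exchange F v" "\<And>X. X \<in> F \<Longrightarrow> finite X"
  shows "basis_exchange F (\<lambda>Z. v Z + sum p Z)"
  unfolding basis_exchange_def
proof (intro ballI)
  fix X Y i assume *: "X \<in> F" "Y \<in> F" "i \<in> X - Y"
  then obtain j where "j \<in> Y - X" "exchangeable F v X Y {i} {j}"
    using assms(1) unfolding basis_exchange_def by meson
  then show "\<exists>j\<in>Y - X. exchangeable F (\<lambda>Z. v Z + sum p Z) X Y {i} {j}"
    using exchangeable_add_sum[of X Y "{i}" "{j}" F v p] assms(2) * by auto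
qed

lemma basis_exchange_maximizers:
  assumes ex: "basis_exchange F v"
  shows "basis_exchange {X \<in> F. \<forall>Z\<in>F. v Z \<le> v X} (\<lambda>_. 0)" (is "basis_exchange ?D _")
  unfolding basis_exchange_def
proof (intro ballI)
  fix X Y i assume *: "X \<in> ?D" "Y \<in> ?D" "i \<in> X - Y"
  then obtain j where j: "j \<in> Y - X" "exchangeable F v X Y {i} {j}"
    using ex unfolding basis_exchange_def by (metis (no_types, lifting) mem_Collect_eq)
  have le: "v Z \<le> v X" "v Z \<le> v Y" if "Z \<in> F" for Z using * that by auto
  have X': "X - {i} \<union> {j} \<in> F" and Y': "Y - {j} \<union> {i} \<in> F"
    and sum: "v X + v Y \<le> v (X - {i} \<union> {j}) + v (Y - {j} \<union> {i})"
    using j(2) unfolding exchangeable_def by auto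
  have "v X \<le> v (X - {i} \<union> {j})" "v Y \<le> v (Y - {j} \<union> {i})"
    using sum le(1)[OF X'] le(2)[OF Y'] by linarith+
  then have "X - {i} \<union> {j} \<in> ?D" "Y - {j} \<union> {i} \<in> ?D"
    using X' Y' le by (auto intro: order_trans)
  then show "\<exists>j\<in>Y - X. exchangeable ?D (\<lambda>_. 0) X Y {i} {j}"
    using j(1) unfolding exchangeable_def by (intro bexI[of _ j]) simp_all
qed

definition basis_rank :: "'a set set \<Rightarrow> 'a set \<Rightarrow> nat" where
  "basis_rank D T = Max ((\<lambda>J. card (J \<inter> T)) ` D)"

lemma basis_rank_ge: "finite D \<Longrightarrow> J \<in> D \<Longrightarrow> card (J \<inter> T) \<le> basis_rank D T"
  unfolding basis_rank_def by (intro Max_ge) auto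

lemma basis_rank_attained:
  assumes "finite D" "D \<noteq> {}"
  obtains J where "J \<in> D" "card (J \<inter> T) = basis_rank D T"
proof -
  have "basis_rank D T \<in> (\<lambda>J. card (J \<inter> T)) ` D" unfolding basis_rank_def using assms by (intro Max_in) auto
  then show ?thesis using that by auto
qed

text \<open>
  This is submodularity of the rank in disguise. Among all pairs of a basis \<open>J\<close> that is optimal for
  \<open>A\<close> and a basis \<open>K\<close> that is optimal for \<open>C\<close>, take one with \<open>card (K - J)\<close> minimal. If \<open>K\<close> had an
  element of \<open>C\<close> outside \<open>J\<close>, exchanging it against \<open>j\<close> could be carried out in \<open>K\<close> (if \<open>j\<close> lies in
  \<open>C\<close>) or in \<open>J\<close> (otherwise) without losing optimality, reducing the difference.
\<close>
lemma basis_rank_attained_nested: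
  assumes D: "finite D" "D \<noteq> {}" "\<And>J. J \<in> D \<Longrightarrow> finite J"
    and ex: "basis_exchange D (\<lambda>_. 0)" and AC: "A \<subseteq> C"
  obtains J where "J \<in> D" "card (J \<inter> A) = basis_rank D A" "card (J \<inter> C) = basis_rank D C"
proof -
  obtain J0 K0 where "J0 \<in> D" "card (J0 \<inter> A) = basis_rank D A" "K0 \<in> D" "card (K0 \<inter> C) = basis_rank D C"
    using basis_rank_attained[OF D(1,2)] by metis
  then obtain JK where JK: "fst JK \<in> D \<and> card (fst JK \<inter> A) = basis_rank D A \<and> snd JK \<in> D \<and> card (snd JK \<inter> C) = basis_rank D C"
    and min: "\<And>JK'. fst JK' \<in> D \<and> card (fst JK' \<inter> A) = basis_rank D A \<and> snd JK' \<in> D \<and> card (snd JK' \<inter> C) = basis_rank D C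
      \<Longrightarrow> card (snd JK - fst JK) \<le> card (snd JK' - fst JK')"
    using ex_has_least_nat[of "\<lambda>JK. fst JK \<in> D \<and> card (fst JK \<inter> A) = basis_rank D A \<and> snd JK \<in> D \<and> card (snd JK \<inter> C) = basis_rank D C"
        "(J0, K0)" "\<lambda>JK. card (snd JK - fst JK)"] by (metis fst_conv snd_conv)
  obtain J K where JK_eq: "JK = (J, K)" by (cases JK)
  note J = JK[unfolded JK_eq fst_conv snd_conv]
  have min: "card (K - J) \<le> card (K' - J')"
    if "J' \<in> D" "card (J' \<inter> A) = basis_rank D A" "K' \<in> D" "card (K' \<inter> C) = basis_rank D C" for J' K'
    using min[of "(J', K')"] that unfolding JK_eq by simp
  have finJ: "finite J" "finite K" using J D(3) by auto
  have "K \<inter> C \<subseteq> J"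
  proof
    fix i assume i: "i \<in> K \<inter> C"
    show "i \<in> J"
    proof (rule ccontr)
      assume iJ: "i \<notin> J"
      obtain j where j: "j \<in> J" "j \<notin> K" "insert j (K - {i}) \<in> D" "insert i (J - {j}) \<in> D"
        using i iJ J by (auto elim: basis_exchangeE[OF ex, of K J i])
      have "card (K - J - {i}) < card (K - J)" using i iJ finJ by (intro card_Diff1_less) auto
      moreover have "card (K - J) \<le> card (K - J - {i})"
      proof (cases "j \<in> C")
        case True
        have "insert j (K - {i}) \<inter> C = insert j (K \<inter> C - {i})" using True i by auto
        then have "card (insert j (K - {i}) \<inter> C) = card (K \<inter> C)"
          using i j(2) finJ card_Suc_Diff1[of "K \<inter> C" i] by (simp add: card_insert_if)
        then have "card (K - J) \<le> card (insert j (K - {i}) - J)" using J j by (intro min) auto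
        also have "insert j (K - {i}) - J = K - J - {i}" using j(1) by auto
        finally show ?thesis .
      next
        case False
        then have "J \<inter> A \<subseteq> insert i (J - {j}) \<inter> A" using AC by auto
        then have "card (J \<inter> A) \<le> card (insert i (J - {j}) \<inter> A)" using finJ by (intro card_mono) auto
        then have "card (insert i (J - {j}) \<inter> A) = basis_rank D A"
          using J basis_rank_ge[OF D(1) j(4), of A] by linarith
        then have "card (K - J) \<le> card (K - insert i (J - {j}))" using J j by (intro min) auto
        also have "K - insert i (J - {j}) = K - J - {i}" using j(2) by auto
        finally show ?thesis .
      qed
      ultimately show False by linarith
    qed
  qed
  then have "card (K \<inter> C) \<le> card (J \<inter> C)" using finJ by (intro card_mono) auto
  then have "card (J \<inter> C) = basis_rank D C" using J basis_rank_ge[OF D(1), of J C] by simp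
  then show ?thesis using that J by blast
qed

lemma rank_function_basis_rank:
  assumes D: "finite D" "D \<noteq> {}" "\<And>J. J \<in> D \<Longrightarrow> finite J"
    and ex: "basis_exchange D (\<lambda>_. 0)" and "finite W"
  shows "rank_function W (basis_rank D)"
  unfolding rank_function_def
proof (intro conjI allI impI)
  fix T assume "T \<subseteq> W"
  then have finT: "finite T" using \<open>finite W\<close> finite_subset by blast
  obtain J where "J \<in> D" "card (J \<inter> T) = basis_rank D T" using basis_rank_attained[OF D(1,2)] .
  then show "basis_rank D T \<le> card T" using card_mono[OF finT, of "J \<inter> T"] by simp
next
  fix S T assume "S \<subseteq> T" "T \<subseteq> W"
  obtain J where J: "J \<in> D" "card (J \<inter> S) = basis_rank D S" using basis_rank_attained[OF D(1,2)] .
  then have "card (J \<inter> S) \<le> card (J \<inter> T)" using D(3) \<open>S \<subseteq> T\<close> by (intro card_mono) auto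
  then show "basis_rank D S \<le> basis_rank D T" using J basis_rank_ge[OF D(1) J(1), of T] by simp
next
  fix S T assume "S \<subseteq> W" "T \<subseteq> W"
  obtain J where J: "J \<in> D" "card (J \<inter> (S \<inter> T)) = basis_rank D (S \<inter> T)" "card (J \<inter> (S \<union> T)) = basis_rank D (S \<union> T)"
    by (rule basis_rank_attained_nested[OF D ex, of "S \<inter> T" "S \<union> T"]) auto
  have "card (J \<inter> S) + card (J \<inter> T) = card ((J \<inter> S) \<union> (J \<inter> T)) + card ((J \<inter> S) \<inter> (J \<inter> T))"
    using D(3)[OF J(1)] by (intro card_Un_Int) auto
  moreover have "(J \<inter> S) \<union> (J \<inter> T) = J \<inter> (S \<union> T)" "(J \<inter> S) \<inter> (J \<inter> T) = J \<inter> (S \<inter> T)" by auto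
  ultimately show "basis_rank D (S \<union> T) + basis_rank D (S \<inter> T) \<le> basis_rank D S + basis_rank D T"
    using J basis_rank_ge[OF D(1) J(1), of S] basis_rank_ge[OF D(1) J(1), of T] by simp
qed

text \<open>
  The condition \<open>meet\<close> says that no set \<open>T\<close> separates the two families by the number of its elements
  in their bases; passing to the complement of \<open>T\<close> in the second family turns it into the covering
  condition of the intersection theorem.
\<close>
lemma common_basis:
  assumes W: "finite W" and D1: "D1 \<subseteq> Pow W" "D1 \<noteq> {}" "basis_exchange D1 (\<lambda>_. 0)" "\<And>J. J \<in> D1 \<Longrightarrow> card J = r"
    and D2: "D2 \<subseteq> Pow W" "D2 \<noteq> {}" "basis_exchange D2 (\<lambda>_. 0)" "\<And>J. J \<in> D2 \<Longrightarrow> card J = r"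
    and meet: "\<And>T. T \<subseteq> W \<Longrightarrow> \<exists>J\<in>D1. \<exists>K\<in>D2. card (K \<inter> T) \<le> card (J \<inter> T)"
  shows "\<exists>J. J \<in> D1 \<and> J \<in> D2"
proof -
  have fin: "finite D1" "finite D2" "\<And>J. J \<in> D1 \<Longrightarrow> finite J" "\<And>J. J \<in> D2 \<Longrightarrow> finite J"
    using W D1(1) D2(1) by (auto intro: finite_subset)
  have "r \<le> basis_rank D1 T + basis_rank D2 (W - T)" if T: "T \<subseteq> W" for T
  proof -
    obtain J K where JK: "J \<in> D1" "K \<in> D2" "card (K \<inter> T) \<le> card (J \<inter> T)" using meet[OF T] by blast
    have "K \<inter> (W - T) = K - T" using JK(2) D2(1) by auto
    then have "r = card (K \<inter> T) + card (K \<inter> (W - T))"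
      using card_Int_Diff[OF fin(4)[OF JK(2)], of T] D2(4)[OF JK(2)] by simp
    also have "\<dots> \<le> basis_rank D1 T + basis_rank D2 (W - T)"
      using JK(3) basis_rank_ge[OF fin(1) JK(1), of T] basis_rank_ge[OF fin(2) JK(2), of "W - T"] by linarith
    finally show ?thesis .
  qed
  then obtain S where S: "S \<subseteq> W" "card S = r" "basis_rank D1 S = r" "basis_rank D2 S = r"
    using common_independent_set[OF W rank_function_basis_rank[OF fin(1) D1(2) fin(3) D1(3) W]
        rank_function_basis_rank[OF fin(2) D2(2) fin(4) D2(3) W], of r] by blast
  have finS: "finite S" using S(1) W finite_subset by blast
  have basis: "S \<in> D" if D: "finite D" "D \<noteq> {}" "\<And>J. J \<in> D \<Longrightarrow> card J = r" "\<And>J. J \<in> D \<Longrightarrow> finite J" "basis_rank D S = r" for D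
  proof -
    obtain J where J: "J \<in> D" "card (J \<inter> S) = basis_rank D S" using basis_rank_attained[OF D(1,2)] .
    then have "J \<inter> S = S" using S(2) finS D(5) by (intro card_subset_eq) auto
    moreover have "J \<inter> S = J" using J D(3)[OF J(1)] D(4)[OF J(1)] D(5) by (intro card_subset_eq) auto
    ultimately show ?thesis using J(1) by simp
  qed
  show ?thesis
    using basis[OF fin(1) D1(2,4) fin(3) S(3)] basis[OF fin(2) D2(2,4) fin(4) S(4)] by blast
qed

lemma finite_gap:
  fixes b :: "'k \<Rightarrow> real"
  assumes "finite S" "\<And>x. x \<in> S \<Longrightarrow> b x \<le> m"
  obtains \<delta> where "\<delta> > 0" "\<forall>x\<in>S. b x \<noteq> m \<longrightarrow> b x + \<delta> < m"
proof (cases "{x \<in> S. b x \<noteq> m} = {}")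
  case True
  then show ?thesis using that[of 1] by auto
next
  case False
  have "finite {x \<in> S. b x \<noteq> m}" using assms(1) by simp
  then obtain z where z: "z \<in> {x \<in> S. b x \<noteq> m}" "\<And>x. x \<in> {x \<in> S. b x \<noteq> m} \<Longrightarrow> b x \<le> b z"
    using finite_maximizer[OF _ False] by blast
  have "b z < m" using z(1) assms(2)[of z] by simp
  have "b x + (m - b z) / 2 < m" if "x \<in> S" "b x \<noteq> m" for x
    using z(2)[of x] that \<open>b z < m\<close> by (simp add: field_simps)
  then show ?thesis using that[of "(m - b z) / 2"] \<open>b z < m\<close> by simp
qed

text \<open>
  The condition \<open>weak\<close> bounds, for all prices \<open>p\<close>, the sum of the maxima of \<open>a\<close> and \<open>b\<close> with prices
  \<open>p\<close> and \<open>- p\<close>. At prices minimizing this sum let \<open>D\<close> and \<open>G\<close> be the sets of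
  maximizers. Raising the prices slightly on a set \<open>T\<close> cannot decrease the sum, so some pair of
  maximizers does not lose by it; this is what \<open>common_basis\<close> needs to provide a common maximizer.
\<close>
lemma intersection_duality:
  fixes a b :: "'a set \<Rightarrow> real"
  assumes W: "finite W"
    and P: "P \<subseteq> Pow W" "basis_exchange P a" "\<And>J. J \<in> P \<Longrightarrow> card J = r"
    and Q: "Q \<subseteq> Pow W" "basis_exchange Q b" "\<And>J. J \<in> Q \<Longrightarrow> card J = r"
    and weak: "\<And>p. \<exists>J\<in>P. \<exists>K\<in>Q. c + sum p K \<le> a J + sum p J + b K"
  shows "\<exists>J. J \<in> P \<and> J \<in> Q \<and> c \<le> a J + b J"
proof -
  have fin: "finite P" "finite Q" "\<And>J. J \<in> P \<Longrightarrow> finite J" "\<And>J. J \<in> Q \<Longrightarrow> finite J"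
    using W P(1) Q(1) by (auto intro: finite_subset)
  define diff :: "'a set \<times> 'a set \<Rightarrow> real \<times> ('a \<Rightarrow> real)" where
    "diff = (\<lambda>(J, K). (a J + b K, \<lambda>w. of_bool (w \<in> J) - of_bool (w \<in> K)))"
  have sum_of_bool: "(\<Sum>w\<in>W. of_bool (w \<in> J) * p w) = sum p J" if "J \<subseteq> W" for J and p :: "'a \<Rightarrow> real"
  proof -
    have "(\<Sum>w\<in>W. of_bool (w \<in> J) * p w) = (\<Sum>w\<in>W. if w \<in> J then p w else 0)" by (intro sum.cong) auto
    also have "\<dots> = sum p (W \<inter> J)" using W by (simp add: sum.inter_restrict)
    finally show ?thesis using that by (simp add: Int_absorb1)
  qed
  have diff_val: "fst (diff (J, K)) + (\<Sum>w\<in>W. snd (diff (J, K)) w * p w) = a J + sum p J + (b K - sum p K)"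
    if "J \<in> P" "K \<in> Q" for J K p
  proof -
    have "J \<subseteq> W" "K \<subseteq> W" using that P(1) Q(1) by auto
    then show ?thesis by (simp add: diff_def left_diff_distrib sum_subtractf sum_of_bool)
  qed
  have "finite (diff ` (P \<times> Q))" using fin by simp
  moreover have "diff ` (P \<times> Q) \<noteq> {}" using weak[of "\<lambda>_. 0"] by auto
  moreover have "\<exists>(x, e)\<in>diff ` (P \<times> Q). c \<le> x + (\<Sum>w\<in>W. e w * p w)" for p
  proof -
    obtain J K where JK: "J \<in> P" "K \<in> Q" "c + sum p K \<le> a J + sum p J + b K" using weak[of p] by blast
    then have "c \<le> fst (diff (J, K)) + (\<Sum>w\<in>W. snd (diff (J, K)) w * p w)"
      unfolding diff_val[OF JK(1,2)] by simp
    then show ?thesis using JK(1,2) unfolding case_prod_beta by blast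
  qed
  ultimately have "\<exists>p. \<forall>q. \<exists>(x, e)\<in>diff ` (P \<times> Q). \<forall>(y, d)\<in>diff ` (P \<times> Q).
      y + (\<Sum>w\<in>W. d w * p w) \<le> x + (\<Sum>w\<in>W. e w * q w)"
    by (rule max_affine_attains_minimum[OF W])
  then obtain p where p: "\<forall>q. \<exists>(x, e)\<in>diff ` (P \<times> Q). \<forall>(y, d)\<in>diff ` (P \<times> Q).
      y + (\<Sum>w\<in>W. d w * p w) \<le> x + (\<Sum>w\<in>W. e w * q w)"
    by (rule exE)
  have opt: "\<exists>J\<in>P. \<exists>K\<in>Q. \<forall>J'\<in>P. \<forall>K'\<in>Q. a J' + sum p J' + (b K' - sum p K') \<le> a J + sum q J + (b K - sum q K)" for q
  proof -
    obtain J K where JK: "J \<in> P" "K \<in> Q" and le: "\<And>z. z \<in> P \<times> Q \<Longrightarrow> fst (diff z) + (\<Sum>w\<in>W. snd (diff z) w * p w)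
        \<le> fst (diff (J, K)) + (\<Sum>w\<in>W. snd (diff (J, K)) w * q w)"
      using spec[OF p, of q] unfolding case_prod_beta by blast
    have "a J' + sum p J' + (b K' - sum p K') \<le> a J + sum q J + (b K - sum q K)"
      if "J' \<in> P" "K' \<in> Q" for J' K'
      using le[of "(J', K')"] that unfolding diff_val[OF JK] diff_val[OF that] by simp
    then show ?thesis using JK by blast
  qed
  define f where "f J = a J + sum p J" for J
  define g where "g K = b K - sum p K" for K
  define D where "D = {J \<in> P. \<forall>Z\<in>P. f Z \<le> f J}"
  define G where "G = {K \<in> Q. \<forall>Z\<in>Q. g Z \<le> g K}"
  have ne: "P \<noteq> {}" "Q \<noteq> {}" using weak[of "\<lambda>_. 0"] by auto
  have D_ex: "basis_exchange D (\<lambda>_. 0)"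
    unfolding D_def f_def by (intro basis_exchange_maximizers basis_exchange_add_sum P(2) fin(3))
  have "basis_exchange Q (\<lambda>K. b K + sum (\<lambda>w. - p w) K)" by (intro basis_exchange_add_sum Q(2) fin(4))
  then have "basis_exchange Q g" unfolding g_def by (simp add: sum_negf)
  then have G_ex: "basis_exchange G (\<lambda>_. 0)" unfolding G_def by (rule basis_exchange_maximizers)
  obtain J0 where J0: "J0 \<in> P" "\<And>J. J \<in> P \<Longrightarrow> f J \<le> f J0" using finite_maximizer[OF fin(1) ne(1)] by blast
  obtain K0 where K0: "K0 \<in> Q" "\<And>K. K \<in> Q \<Longrightarrow> g K \<le> g K0" using finite_maximizer[OF fin(2) ne(2)] by blast
  have "J0 \<in> D" "K0 \<in> G" using J0 K0 unfolding D_def G_def by auto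
  have val: "f J + g K \<le> f J0 + g K0" if "J \<in> P" "K \<in> Q" for J K
    using J0(2)[OF that(1)] K0(2)[OF that(2)] by simp
  have tight: "J \<in> D" "K \<in> G" if "J \<in> P" "K \<in> Q" "f J + g K = f J0 + g K0" for J K
    using that J0 K0 unfolding D_def G_def by (smt (verit, best) mem_Collect_eq)+
  have meet: "\<exists>J\<in>D. \<exists>K\<in>G. card (K \<inter> T) \<le> card (J \<inter> T)" if T: "T \<subseteq> W" for T
  proof (rule ccontr)
    assume "\<not> ?thesis"
    then have less: "card (J \<inter> T) < card (K \<inter> T)" if "J \<in> D" "K \<in> G" for J K using that by (meson not_le)
    have finT: "finite T" using T W finite_subset by blast
    have "finite (P \<times> Q)" using fin by simp
    moreover have "f (fst z) + g (snd z) \<le> f J0 + g K0" if "z \<in> P \<times> Q" for z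
      using val that by auto
    ultimately obtain \<delta> where \<delta>: "\<delta> > 0"
      "\<forall>z\<in>P \<times> Q. f (fst z) + g (snd z) \<noteq> f J0 + g K0 \<longrightarrow> f (fst z) + g (snd z) + \<delta> < f J0 + g K0"
      by (rule finite_gap)
    \<comment> \<open>Small enough that a pair that is not optimal at the prices p stays below the optimum at the prices q.\<close>
    define \<epsilon> where "\<epsilon> = \<delta> / (card T + 1)"
    have \<epsilon>: "\<epsilon> > 0" "\<epsilon> * card T \<le> \<delta>" using \<delta>(1) unfolding \<epsilon>_def by (auto simp: field_simps)
    define q where "q w = p w + (if w \<in> T then \<epsilon> else 0)" for w
    have sum_q: "sum q J = sum p J + \<epsilon> * card (J \<inter> T)" if "finite J" for J
      unfolding q_def using that by (simp add: sum.distrib sum.inter_restrict[symmetric])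
    obtain J K where JK: "J \<in> P" "K \<in> Q" "f J0 + g K0 \<le> a J + sum q J + (b K - sum q K)"
      using opt[of q] J0(1) K0(1) unfolding f_def g_def by blast
    have ge: "f J0 + g K0 \<le> f J + g K + \<epsilon> * (real (card (J \<inter> T)) - real (card (K \<inter> T)))"
      using JK(3) sum_q[OF fin(3)[OF JK(1)]] sum_q[OF fin(4)[OF JK(2)]] unfolding f_def g_def
      by (simp add: algebra_simps)
    show False
    proof (cases "f J + g K = f J0 + g K0")
      case True
      then have "card (J \<inter> T) < card (K \<inter> T)" using less tight[OF JK(1,2)] by blast
      then have "\<epsilon> * (real (card (J \<inter> T)) - real (card (K \<inter> T))) < 0" using \<epsilon>(1) by (intro mult_pos_neg) auto
      then show False using ge True by linarith
    next
      case False
      have "card (J \<inter> T) \<le> card T" using finT by (intro card_mono) auto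
      then have "\<epsilon> * (real (card (J \<inter> T)) - real (card (K \<inter> T))) \<le> \<epsilon> * real (card T)"
        using \<epsilon>(1) by (intro mult_left_mono) auto
      moreover have "f J + g K + \<delta> < f J0 + g K0" using bspec[OF \<delta>(2), of "(J, K)"] False JK(1,2) by simp
      ultimately show False using ge \<epsilon>(2) by linarith
    qed
  qed
  have sub: "D \<subseteq> P" "G \<subseteq> Q" unfolding D_def G_def by auto
  have "\<exists>J. J \<in> D \<and> J \<in> G"
  proof (rule common_basis[OF W _ _ D_ex _ _ _ G_ex _ meet])
    show "D \<subseteq> Pow W" "G \<subseteq> Pow W" using sub P(1) Q(1) by auto
    show "D \<noteq> {}" "G \<noteq> {}" using \<open>J0 \<in> D\<close> \<open>K0 \<in> G\<close> by auto
    show "J \<in> D \<Longrightarrow> card J = r" "J \<in> G \<Longrightarrow> card J = r" for J using sub P(3) Q(3) by auto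
  qed
  then obtain J where J: "J \<in> D" "J \<in> G" by blast
  obtain J1 K1 where "J1 \<in> P" "K1 \<in> Q" "c + sum p K1 \<le> a J1 + sum p J1 + b K1" using weak[of p] by blast
  then have "c \<le> f J1 + g K1" unfolding f_def g_def by simp
  also have "\<dots> \<le> f J + g J" using J \<open>J1 \<in> P\<close> \<open>K1 \<in> Q\<close> unfolding D_def G_def by (simp add: add_mono)
  also have "\<dots> = a J + b J" unfolding f_def g_def by simp
  finally show ?thesis using J unfolding D_def G_def by blast
qed

text \<open>
  Both ways of completing \<open>I\<close>, as functions of \<open>J \<subseteq> Y - X\<close>, inherit the exchange property, in the
  second case with the roles of the two arguments interchanged because \<open>J\<close> is removed.
\<close>
theorem basis_multiple_exchange:
  assumes E: "finite E" "F \<subseteq> Pow E" and card: "\<And>Z. Z \<in> F \<Longrightarrow> card Z = n"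
    and ex: "basis_exchange F v" and F: "X \<in> F" "Y \<in> F" and I: "I \<subseteq> X - Y"
  shows "\<exists>J\<subseteq>Y - X. card J = card I \<and> exchangeable F v X Y I J"
proof -
  define W where "W = Y - X"
  define P where "P = {J. J \<subseteq> W \<and> X - I \<union> J \<in> F}"
  define Q where "Q = {J. J \<subseteq> W \<and> Y - J \<union> I \<in> F}"
  have fin: "finite X" "finite Y" using E F finite_subset by blast+
  have finW: "finite W" and finI: "finite I" using fin I finite_subset unfolding W_def by auto
  have IX: "I \<subseteq> X" "I \<inter> Y = {}" and WY: "W \<subseteq> Y" "W \<inter> X = {}" using I unfolding W_def by auto
  have cI: "card I \<le> card X" using IX fin by (intro card_mono) auto
  have cP: "card J = card I" if "J \<in> P" for J
  proof -
    have J: "J \<subseteq> W" "X - I \<union> J \<in> F" using that unfolding P_def by auto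
    have "card (X - I \<union> J) = card (X - I) + card J"
      using J WY fin finW finite_subset by (intro card_Un_disjoint) auto
    then show ?thesis using card[OF J(2)] card[OF F(1)] card_Diff_subset[OF finI IX(1)] cI by simp
  qed
  have cQ: "card J = card I" if "J \<in> Q" for J
  proof -
    have J: "J \<subseteq> W" "Y - J \<union> I \<in> F" using that unfolding Q_def by auto
    have "card (Y - J \<union> I) = card (Y - J) + card I"
      using IX fin finI by (intro card_Un_disjoint) auto
    moreover have "card (Y - J) = card Y - card J" "card J \<le> card Y"
      using J WY fin finW finite_subset[OF J(1)] by (auto intro!: card_Diff_subset card_mono)
    ultimately show ?thesis using card[OF J(2)] card[OF F(2)] by simp
  qed
  have P_ex: "basis_exchange P (\<lambda>J. v (X - I \<union> J))"
    unfolding basis_exchange_def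
  proof (intro ballI)
    fix J K i assume J: "J \<in> P" and K: "K \<in> P" and i: "i \<in> J - K"
    have JK: "J \<subseteq> W" "X - I \<union> J \<in> F" "K \<subseteq> W" "X - I \<union> K \<in> F" using J K unfolding P_def by auto
    have iJK: "i \<in> X - I \<union> J" "i \<notin> X - I \<union> K" "i \<notin> X" using i JK WY by auto
    obtain j where j: "j \<in> X - I \<union> K" "j \<notin> X - I \<union> J" "insert j (X - I \<union> J - {i}) \<in> F"
      "insert i (X - I \<union> K - {j}) \<in> F"
      "v (X - I \<union> J) + v (X - I \<union> K) \<le> v (insert j (X - I \<union> J - {i})) + v (insert i (X - I \<union> K - {j}))"
      by (rule basis_exchangeE[OF ex JK(2,4) iJK(1,2)])
    have jK: "j \<in> K" "j \<notin> J" "j \<notin> X" using j JK WY by auto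
    have "insert j (X - I \<union> J - {i}) = X - I \<union> (J - {i} \<union> {j})"
      "insert i (X - I \<union> K - {j}) = X - I \<union> (K - {j} \<union> {i})" using iJK jK by auto
    then have "exchangeable P (\<lambda>J. v (X - I \<union> J)) J K {i} {j}"
      using j JK i jK unfolding exchangeable_def P_def by auto
    then show "\<exists>j\<in>K - J. exchangeable P (\<lambda>J. v (X - I \<union> J)) J K {i} {j}" using jK by blast
  qed
  have Q_ex: "basis_exchange Q (\<lambda>J. v (Y - J \<union> I))"
    unfolding basis_exchange_def
  proof (intro ballI)
    fix J K i assume J: "J \<in> Q" and K: "K \<in> Q" and i: "i \<in> J - K"
    have JK: "J \<subseteq> W" "Y - J \<union> I \<in> F" "K \<subseteq> W" "Y - K \<union> I \<in> F" using J K unfolding Q_def by auto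
    have iW: "i \<in> Y" "i \<notin> I" "i \<in> J" "i \<notin> K" using i JK WY IX by auto
    have iJK: "i \<in> Y - K \<union> I" "i \<notin> Y - J \<union> I" using iW by auto
    obtain j where j: "j \<in> Y - J \<union> I" "j \<notin> Y - K \<union> I" "insert j (Y - K \<union> I - {i}) \<in> F"
      "insert i (Y - J \<union> I - {j}) \<in> F"
      "v (Y - K \<union> I) + v (Y - J \<union> I) \<le> v (insert j (Y - K \<union> I - {i})) + v (insert i (Y - J \<union> I - {j}))"
      by (rule basis_exchangeE[OF ex JK(4,2) iJK])
    have jK: "j \<in> K" "j \<notin> J" "j \<in> Y" "j \<notin> I" using j JK WY by auto
    have "insert j (Y - K \<union> I - {i}) = Y - (K - {j} \<union> {i}) \<union> I"
      "insert i (Y - J \<union> I - {j}) = Y - (J - {i} \<union> {j}) \<union> I" using iW jK by auto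
    then have "exchangeable Q (\<lambda>J. v (Y - J \<union> I)) J K {i} {j}"
      using j JK i jK unfolding exchangeable_def Q_def by auto
    then show "\<exists>j\<in>K - J. exchangeable Q (\<lambda>J. v (Y - J \<union> I)) J K {i} {j}" using jK by blast
  qed
  have "\<exists>J. J \<in> P \<and> J \<in> Q \<and> v X + v Y \<le> v (X - I \<union> J) + v (Y - J \<union> I)"
  proof (rule intersection_duality[OF finW _ P_ex cP _ Q_ex cQ])
    show "P \<subseteq> Pow W" "Q \<subseteq> Pow W" unfolding P_def Q_def by auto
    show "\<exists>J\<in>P. \<exists>K\<in>Q. v X + v Y + sum p K \<le> v (X - I \<union> J) + sum p J + v (Y - K \<union> I)" for p
      using relaxed_multiple_exchange[OF E basis_imp_single_exchange[OF ex] F I, of p]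
      unfolding P_def Q_def W_def by auto
  qed
  then obtain J where J: "J \<in> P" "J \<in> Q" "v X + v Y \<le> v (X - I \<union> J) + v (Y - J \<union> I)" by blast
  then have "exchangeable F v X Y I J" "J \<subseteq> Y - X" unfolding exchangeable_def P_def Q_def W_def by auto
  then show ?thesis using cP[OF J(1)] by blast
qed

section \<open>From single to multiple exchange\<close>

text \<open>
  Copies \<open>Inr d\<close> of the elements of \<open>N\<close> serve as dummies: every set \<open>X\<close> of \<open>F\<close> is filled up to
  cardinality \<open>card N\<close> by arbitrary \<open>card (N - X)\<close> of them.
\<close>
definition homogenization :: "'a set \<Rightarrow> 'a set set \<Rightarrow> ('a + 'a) set set" where
  "homogenization N F = {Z. Z \<subseteq> N <+> N \<and> card Z = card N \<and> Inl -` Z \<in> F}"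

text \<open>
  The exchange partner of an element \<open>i\<close> of \<open>X\<close> is found by balanced exchange if \<open>X\<close> is no larger than
  \<open>Y\<close>; otherwise \<open>Y\<close> has more dummies than \<open>X\<close>, and one of these compensates if nothing else does.
  A dummy is exchanged against a dummy if possible; otherwise \<open>Y\<close> is larger than \<open>X\<close> and gives away
  an element.
\<close>
lemma basis_exchange_homogenization:
  assumes N: "finite N" "F \<subseteq> Pow N" and ex: "single_exchange F v"
  shows "basis_exchange (homogenization N F) (\<lambda>Z. v (Inl -` Z))"
  unfolding basis_exchange_def
proof (intro ballI)
  fix Z1 Z2 u assume Z1: "Z1 \<in> homogenization N F" and Z2: "Z2 \<in> homogenization N F" and u: "u \<in> Z1 - Z2"
  let ?v = "\<lambda>Z. v (Inl -` Z)" and ?H = "homogenization N F"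
  define X where "X = Inl -` Z1"
  define Y where "Y = Inl -` Z2"
  define S where "S = Inr -` Z1"
  define T where "T = Inr -` Z2"
  have sub: "Z1 \<subseteq> N <+> N" "Z2 \<subseteq> N <+> N" using Z1 Z2 unfolding homogenization_def by auto
  have fin: "finite Z1" "finite Z2" using sub N(1) by (auto intro: finite_subset)
  have F: "X \<in> F" "Y \<in> F" using Z1 Z2 unfolding homogenization_def X_def Y_def by auto
  have split: "Z1 = X <+> S" "Z2 = Y <+> T"
    unfolding X_def Y_def S_def T_def by (auto simp: Plus_def) (metis sum.exhaust rangeI image_eqI)+
  have finXS: "finite X" "finite Y" "finite S" "finite T"
    using fin unfolding X_def Y_def S_def T_def by (auto intro: finite_vimageI)
  have cards: "card X + card S = card Y + card T"
    using Z1 Z2 finXS card_Plus[of X S] card_Plus[of Y T] unfolding homogenization_def split by auto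
  have goal: "\<exists>w\<in>Z2 - Z1. exchangeable ?H ?v Z1 Z2 {u} {w}"
    if w: "w \<in> Z2 - Z1" and mem: "Inl -` (insert w (Z1 - {u})) \<in> F" "Inl -` (insert u (Z2 - {w})) \<in> F"
      and le: "v X + v Y \<le> v (Inl -` (insert w (Z1 - {u}))) + v (Inl -` (insert u (Z2 - {w})))" for w
  proof -
    have "card (insert w (Z1 - {u})) = card Z1" "card (insert u (Z2 - {w})) = card Z2"
      using w u fin card_Suc_Diff1[of Z1 u] card_Suc_Diff1[of Z2 w] by (simp_all add: card_insert_if)
    then have "insert w (Z1 - {u}) \<in> ?H" "insert u (Z2 - {w}) \<in> ?H"
      using mem Z1 Z2 w u unfolding homogenization_def by auto
    then have "exchangeable ?H ?v Z1 Z2 {u} {w}"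
      using le unfolding exchangeable_def X_def Y_def by simp
    then show ?thesis using w by blast
  qed
  show "\<exists>w\<in>Z2 - Z1. exchangeable ?H ?v Z1 Z2 {u} {w}"
  proof (cases u)
    case (Inl i)
    have i: "i \<in> X" "i \<notin> Y" using u Inl unfolding X_def Y_def by auto
    have element: ?thesis if "j \<in> Y - X" "exchangeable F v X Y {i} {j}" for j
    proof (rule goal[of "Inl j"])
      have "Inl -` insert (Inl j) (Z1 - {u}) = X - {i} \<union> {j}" "Inl -` insert u (Z2 - {Inl j}) = Y - {j} \<union> {i}"
        using Inl i that unfolding X_def Y_def by auto
      then show "Inl -` insert (Inl j) (Z1 - {u}) \<in> F" "Inl -` insert u (Z2 - {Inl j}) \<in> F"
        "v X + v Y \<le> v (Inl -` insert (Inl j) (Z1 - {u})) + v (Inl -` insert u (Z2 - {Inl j}))"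
        using that(2) unfolding exchangeable_def by auto
    qed (use that in \<open>auto simp: X_def Y_def\<close>)
    show ?thesis
    proof (cases "card X \<le> card Y")
      case True
      then show ?thesis using balanced_exchange[OF N ex F True i] element by blast
    next
      case False
      obtain J where J: "J \<subseteq> Y - X" "card J \<le> 1" "X - {i} \<union> J \<in> F" "insert i (Y - J) \<in> F"
        "v X + v Y \<le> v (X - {i} \<union> J) + v (insert i (Y - J))"
        by (rule single_exchangeE[OF ex F i])
      have exJ: "exchangeable F v X Y {i} J" using J unfolding exchangeable_def by simp
      have "finite J" using J(1) finXS finite_subset by blast
      from this J(2) show ?thesis
      proof (rule card_le_1_cases)
        fix j assume "J = {j}"
        then show ?thesis using element exJ J(1) by blast
      next
        assume J0: "J = {}"
        have "card S < card T" using cards False by simp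
        then obtain d where d: "d \<in> T" "d \<notin> S" using card_mono[OF finXS(3), of T] by fastforce
        show ?thesis
        proof (rule goal[of "Inr d"])
          have "Inl -` insert (Inr d) (Z1 - {u}) = X - {i}" "Inl -` insert u (Z2 - {Inr d}) = insert i Y"
            using Inl unfolding X_def Y_def by auto
          then show "Inl -` insert (Inr d) (Z1 - {u}) \<in> F" "Inl -` insert u (Z2 - {Inr d}) \<in> F"
            "v X + v Y \<le> v (Inl -` insert (Inr d) (Z1 - {u})) + v (Inl -` insert u (Z2 - {Inr d}))"
            using J J0 by auto
        qed (use d in \<open>auto simp: S_def T_def\<close>)
      qed
    qed
  next
    case (Inr d)
    have d: "d \<in> S" "d \<notin> T" using u Inr unfolding S_def T_def by auto
    show ?thesis
    proof (cases "T \<subseteq> S")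
      case False
      then obtain d' where d': "d' \<in> T" "d' \<notin> S" by blast
      show ?thesis
      proof (rule goal[of "Inr d'"])
        have "Inl -` insert (Inr d') (Z1 - {u}) = X" "Inl -` insert u (Z2 - {Inr d'}) = Y"
          using Inr unfolding X_def Y_def by auto
        then show "Inl -` insert (Inr d') (Z1 - {u}) \<in> F" "Inl -` insert u (Z2 - {Inr d'}) \<in> F"
          "v X + v Y \<le> v (Inl -` insert (Inr d') (Z1 - {u})) + v (Inl -` insert u (Z2 - {Inr d'}))"
          using F by auto
      qed (use d' in \<open>auto simp: S_def T_def\<close>)
    next
      case True
      then have "card T < card S" using d finXS by (intro psubset_card_mono) auto
      then have "card X < card Y" using cards by simp
      then obtain j where j: "j \<in> Y - X" "insert j X \<in> F" "Y - {j} \<in> F" "v X + v Y \<le> v (insert j X) + v (Y - {j})"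
        using size_increasing_exchange[OF N ex F(1,1,2)] by blast
      show ?thesis
      proof (rule goal[of "Inl j"])
        have "Inl -` insert (Inl j) (Z1 - {u}) = insert j X" "Inl -` insert u (Z2 - {Inl j}) = Y - {j}"
          using Inr unfolding X_def Y_def by auto
        then show "Inl -` insert (Inl j) (Z1 - {u}) \<in> F" "Inl -` insert u (Z2 - {Inl j}) \<in> F"
          "v X + v Y \<le> v (Inl -` insert (Inl j) (Z1 - {u})) + v (Inl -` insert u (Z2 - {Inl j}))"
          using j by auto
      qed (use j in \<open>auto simp: X_def Y_def\<close>)
    qed
  qed
qed

text \<open>
  An exchange in the homogenization compensates the \<open>card I\<close> elements of \<open>I\<close> by as many others; those
  among them that are not dummies form \<open>J\<close>.
\<close>
theorem single_imp_multiple_exchange: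
  assumes N: "finite N" "F \<subseteq> Pow N" and ex: "single_exchange F v"
    and F: "X \<in> F" "Y \<in> F" and I: "I \<subseteq> X - Y"
  shows "\<exists>J\<subseteq>Y - X. card J \<le> card I \<and> exchangeable F v X Y I J"
proof -
  let ?v = "\<lambda>Z. v (Inl -` Z)" and ?H = "homogenization N F"
  define pad :: "'a set \<Rightarrow> ('a + 'a) set" where "pad Z = Z <+> (N - Z)" for Z
  have pad_Inl: "Inl -` pad Z = Z" for Z unfolding pad_def by auto
  have pad_in: "pad Z \<in> ?H" if Z: "Z \<in> F" for Z
  proof -
    have "Z \<subseteq> N" using Z N by auto
    then have "card (pad Z) = card N"
      unfolding pad_def using N(1) card_mono[OF N(1), of Z] finite_subset[of Z N]
      by (simp add: card_Plus card_Diff_subset)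
    moreover have "pad Z \<subseteq> N <+> N" unfolding pad_def using \<open>Z \<subseteq> N\<close> by auto
    ultimately show ?thesis using Z pad_Inl unfolding homogenization_def by auto
  qed
  have E: "finite (N <+> N)" "?H \<subseteq> Pow (N <+> N)" using N unfolding homogenization_def by auto
  have "Inl ` I \<subseteq> pad X - pad Y" using I unfolding pad_def by auto
  then have "\<exists>J\<subseteq>pad Y - pad X. card J = card (Inl ` I :: ('a + 'a) set) \<and> exchangeable ?H ?v (pad X) (pad Y) (Inl ` I) J"
    by (intro basis_multiple_exchange[OF E _ basis_exchange_homogenization[OF N ex] pad_in[OF F(1)] pad_in[OF F(2)], of "card N"])
       (auto simp: homogenization_def)
  then obtain K where K: "K \<subseteq> pad Y - pad X" "card K = card (Inl ` I :: ('a + 'a) set)"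
    "exchangeable ?H ?v (pad X) (pad Y) (Inl ` I) K" by blast
  define J where "J = Inl -` K"
  have eq: "Inl -` (pad X - Inl ` I \<union> K) = X - I \<union> J" "Inl -` (pad Y - K \<union> Inl ` I) = Y - J \<union> I"
    using pad_Inl[of X] pad_Inl[of Y] unfolding J_def by auto
  have "exchangeable F v X Y I J"
    using K(3) unfolding exchangeable_def homogenization_def mem_Collect_eq eq pad_Inl by simp
  moreover have "J \<subseteq> Y - X"
    using vimage_mono[OF K(1), of Inl] unfolding vimage_Diff pad_Inl J_def .
  moreover have "finite K"
    using K(1) pad_in[OF F(2)] E by (meson Diff_subset PowD finite_subset subsetD)
  then have "card J \<le> card K" unfolding J_def using card_vimage_inj_on_le[of Inl UNIV K] by simp
  then have "card J \<le> card I" using K(2) by (simp add: card_image)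
  ultimately show ?thesis by blast
qed

section \<open>Translation to extended real values\<close>

lemma le_Max_ext_iff:
  assumes "finite A"
  shows "c \<le> Max_ext A \<longleftrightarrow> c = -\<infinity> \<or> (\<exists>a\<in>A. c \<le> a)"
  using assms unfolding Max_ext_def by (auto simp: Max_ge_iff)

lemma add_le_add_iff_exchangeable:
  fixes f :: "'a set \<Rightarrow> ereal"
  assumes f: "set_function N f" and "X \<subseteq> N" "Y \<subseteq> N" "I \<subseteq> X - Y" "J \<subseteq> Y - X"
  shows "f X + f Y \<le> f ((X - I) \<union> J) + f ((Y - J) \<union> I) \<longleftrightarrow> f X = -\<infinity> \<or> f Y = -\<infinity> \<or>
    exchangeable {Z. Z \<subseteq> N \<and> f Z \<noteq> -\<infinity>} (\<lambda>Z. real_of_ereal (f Z)) X Y I J"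
proof -
  have sub: "(X - I) \<union> J \<subseteq> N" "(Y - J) \<union> I \<subseteq> N" using assms by auto
  have "f X \<noteq> \<infinity>" "f Y \<noteq> \<infinity>" "f ((X - I) \<union> J) \<noteq> \<infinity>" "f ((Y - J) \<union> I) \<noteq> \<infinity>"
    using f sub assms unfolding set_function_def by blast+
  then show ?thesis using sub unfolding exchangeable_def
    by (cases "f X"; cases "f Y"; cases "f ((X - I) \<union> J)"; cases "f ((Y - J) \<union> I)") auto
qed

text \<open>
  The bridge to the extended reals: a comparison with the maximum, possibly over the empty set, means
  that the left-hand side is \<open>-\<infinity>\<close> or that some exchange is possible.
\<close>
lemma le_Max_ext_iff_exchangeable:
  fixes f :: "'a set \<Rightarrow> ereal"
  assumes N: "finite N" and f: "set_function N f" and XY: "X \<subseteq> N" "Y \<subseteq> N" "I \<subseteq> X - Y"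
    and P: "\<And>J. P J \<Longrightarrow> J \<subseteq> Y - X"
  shows "f X + f Y \<le> Max_ext {f ((X - I) \<union> J) + f ((Y - J) \<union> I) | J. P J} \<longleftrightarrow>
    f X = -\<infinity> \<or> f Y = -\<infinity> \<or>
    (\<exists>J. P J \<and> exchangeable {Z. Z \<subseteq> N \<and> f Z \<noteq> -\<infinity>} (\<lambda>Z. real_of_ereal (f Z)) X Y I J)"
proof -
  have "{J. P J} \<subseteq> Pow N" using P XY by auto
  then have "finite {J. P J}" using N by (simp add: finite_subset)
  then have "finite {f ((X - I) \<union> J) + f ((Y - J) \<union> I) | J. P J}" by simp
  moreover have "f X + f Y = -\<infinity> \<longleftrightarrow> f X = -\<infinity> \<or> f Y = -\<infinity>"
    using f XY unfolding set_function_def by (cases "f X"; cases "f Y") auto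
  ultimately show ?thesis
    using add_le_add_iff_exchangeable[OF f XY P] by (auto simp: le_Max_ext_iff)
qed

lemma M_nat_EXC_m_iff:
  assumes "finite N" "set_function N f"
  shows "M_nat_EXC_m N f \<longleftrightarrow> multiple_exchange {Z. Z \<subseteq> N \<and> f Z \<noteq> -\<infinity>} (\<lambda>Z. real_of_ereal (f Z))"
    (is "_ \<longleftrightarrow> multiple_exchange ?F ?v")
proof -
  have "M_nat_EXC_m N f \<longleftrightarrow> (\<forall>X Y I. X \<subseteq> N \<longrightarrow> Y \<subseteq> N \<longrightarrow> I \<subseteq> X - Y \<longrightarrow>
      f X = -\<infinity> \<or> f Y = -\<infinity> \<or> (\<exists>J. J \<subseteq> Y - X \<and> exchangeable ?F ?v X Y I J))"
    unfolding M_nat_EXC_m_def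
    by (intro iff_allI imp_cong refl le_Max_ext_iff_exchangeable[OF assms]) auto
  also have "\<dots> \<longleftrightarrow> multiple_exchange ?F ?v"
    unfolding multiple_exchange_def Ball_def mem_Collect_eq by meson
  finally show ?thesis .
qed

lemma M_nat_EXC_ms_iff:
  assumes "finite N" "set_function N f"
  shows "M_nat_EXC_ms N f \<longleftrightarrow> (\<forall>X\<in>{Z. Z \<subseteq> N \<and> f Z \<noteq> -\<infinity>}. \<forall>Y\<in>{Z. Z \<subseteq> N \<and> f Z \<noteq> -\<infinity>}. \<forall>I\<subseteq>X - Y.
    \<exists>J\<subseteq>Y - X. card J \<le> card I \<and>
      exchangeable {Z. Z \<subseteq> N \<and> f Z \<noteq> -\<infinity>} (\<lambda>Z. real_of_ereal (f Z)) X Y I J)"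
    (is "_ \<longleftrightarrow> ?rhs")
proof -
  let ?F = "{Z. Z \<subseteq> N \<and> f Z \<noteq> -\<infinity>}" and ?v = "\<lambda>Z. real_of_ereal (f Z)"
  have "M_nat_EXC_ms N f \<longleftrightarrow> (\<forall>X Y I. X \<subseteq> N \<longrightarrow> Y \<subseteq> N \<longrightarrow> I \<subseteq> X - Y \<longrightarrow>
      f X = -\<infinity> \<or> f Y = -\<infinity> \<or> (\<exists>J. (J \<subseteq> Y - X \<and> card J \<le> card I) \<and> exchangeable ?F ?v X Y I J))"
    unfolding M_nat_EXC_ms_def
    by (intro iff_allI imp_cong refl le_Max_ext_iff_exchangeable[OF assms]) auto
  also have "\<dots> \<longleftrightarrow> ?rhs"
    unfolding Ball_def mem_Collect_eq conj_assoc by meson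
  finally show ?thesis .
qed

lemma M_nat_EXC_iff:
  assumes "finite N" "set_function N f"
  shows "M_nat_EXC N f \<longleftrightarrow> single_exchange {Z. Z \<subseteq> N \<and> f Z \<noteq> -\<infinity>} (\<lambda>Z. real_of_ereal (f Z))"
    (is "_ \<longleftrightarrow> single_exchange ?F ?v")
proof -
  have step: "f X + f Y \<le> max (f (X - {i}) + f (Y \<union> {i}))
        (Max_ext {f ((X - {i}) \<union> {j}) + f ((Y \<union> {i}) - {j}) | j. j \<in> Y - X}) \<longleftrightarrow>
      f X = -\<infinity> \<or> f Y = -\<infinity> \<or> (\<exists>J\<subseteq>Y - X. card J \<le> 1 \<and> exchangeable ?F ?v X Y {i} J)"
    if XY: "X \<subseteq> N" "Y \<subseteq> N" "i \<in> X - Y" for X Y i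
  proof -
    have finB: "finite (Y - X)" using XY \<open>finite N\<close> by (auto intro: finite_subset)
    have split: "(J \<subseteq> Y - X \<and> card J \<le> 1) \<longleftrightarrow> J = {} \<or> (\<exists>j\<in>Y - X. J = {j})" for J
    proof
      assume J: "J \<subseteq> Y - X \<and> card J \<le> 1"
      then have "finite J" using finB finite_subset by blast
      then show "J = {} \<or> (\<exists>j\<in>Y - X. J = {j})"
        using J by (elim conjE) (rule card_le_1_cases[of J], auto)
    qed auto
    let ?g = "\<lambda>J. f ((X - {i}) \<union> J) + f ((Y - J) \<union> {i})"
    have singles: "{f ((X - {i}) \<union> {j}) + f ((Y \<union> {i}) - {j}) | j. j \<in> Y - X} = {?g {j} | j. j \<in> Y - X}"
    proof -
      have "Y \<union> {i} - {j} = Y - {j} \<union> {i}" if "j \<in> Y - X" for j using that XY by auto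
      then show ?thesis unfolding setcompr_eq_image by (intro image_cong refl) (simp only: mem_Collect_eq)
    qed
    have fin: "finite {?g {j} | j. j \<in> Y - X}"
      unfolding setcompr_eq_image using finB by (simp only: Collect_mem_eq finite_imageI)
    have "{J. J \<subseteq> Y - X \<and> card J \<le> 1} = insert {} ((\<lambda>j. {j}) ` {j. j \<in> Y - X})"
      unfolding split by blast
    then have "{?g J | J. J \<subseteq> Y - X \<and> card J \<le> 1} = insert (?g {}) {?g {j} | j. j \<in> Y - X}"
      by (simp only: setcompr_eq_image image_insert image_image)
    then have "Max_ext {?g J | J. J \<subseteq> Y - X \<and> card J \<le> 1} = max (?g {}) (Max_ext {?g {j} | j. j \<in> Y - X})"
      using fin by (simp only: Max_ext_eq_Sup finite_insert Sup_insert sup_max)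
    moreover have "{i} \<subseteq> X - Y" using XY by simp
    ultimately show ?thesis
      using le_Max_ext_iff_exchangeable[OF assms XY(1,2), of "{i}" "\<lambda>J. J \<subseteq> Y - X \<and> card J \<le> 1"]
      unfolding singles by (simp add: conj_assoc)
  qed
  have "M_nat_EXC N f \<longleftrightarrow> (\<forall>X Y i. X \<subseteq> N \<longrightarrow> Y \<subseteq> N \<longrightarrow> i \<in> X - Y \<longrightarrow>
      f X = -\<infinity> \<or> f Y = -\<infinity> \<or> (\<exists>J\<subseteq>Y - X. card J \<le> 1 \<and> exchangeable ?F ?v X Y {i} J))"
    unfolding M_nat_EXC_def by (intro iff_allI imp_cong refl step)
  also have "\<dots> \<longleftrightarrow> single_exchange ?F ?v"
    unfolding single_exchange_def Ball_def mem_Collect_eq by meson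
  finally show ?thesis .
qed

theorem corollary1:
  fixes N :: "'a set" and f :: "'a set \<Rightarrow> ereal"
  assumes "finite N"
    and "set_function N f"
  shows "(M_nat_EXC N f \<longleftrightarrow> M_nat_EXC_m N f) \<and> (M_nat_EXC_m N f \<longleftrightarrow> M_nat_EXC_ms N f)"
proof -
  have dom: "{Z. Z \<subseteq> N \<and> f Z \<noteq> -\<infinity>} \<subseteq> Pow N" by auto
  have "M_nat_EXC_m N f \<Longrightarrow> M_nat_EXC N f"
    unfolding M_nat_EXC_m_iff[OF assms] M_nat_EXC_iff[OF assms]
    by (rule multiple_imp_single_exchange[OF assms(1) dom])
  moreover have "M_nat_EXC N f \<Longrightarrow> M_nat_EXC_ms N f"
    unfolding M_nat_EXC_ms_iff[OF assms] M_nat_EXC_iff[OF assms]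
    using single_imp_multiple_exchange[OF assms(1) dom] by simp
  moreover have "M_nat_EXC_ms N f \<Longrightarrow> M_nat_EXC_m N f"
    unfolding M_nat_EXC_ms_iff[OF assms] M_nat_EXC_m_iff[OF assms] multiple_exchange_def by meson
  ultimately show ?thesis by blast
qed

end
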